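(* Let $\mathcal{H}$ be a separable quaternionic Hilbert space, let $J\in\mathcal{B}(\mathcal{H})$ be anti-selfadjoint and unitary, and let $i\in\mathbb{S}$. Suppose that $T$ is a compact operator on $\mathcal{H}$ with $[T,J]=0$ and that $p\in[1,+\infty)$. Then $T$ is in $S_p(J)$ if and only if $$\sum_{n}|\langle \sigma_n,Te_n\rangle|^p<+\infty$$ for all orthonormal sets $\{e_n\}$ and $\{\sigma_n\}$ in $\mathcal{H}_+^{Ji}$. If $T$ is also positive, then $$\|T\|_p=\sup\left\{\Big[\sum_{n}|\langle \sigma_n,Te_n\rangle|^p\Big]^{\frac1p}:\{e_n\}\text{ and }\{\sigma_n\}\text{ orthonormal sets in }\mathcal{H}_+^{Ji}\right\}.$$
   Context: $\mathbb{H}$ denotes the quaternions, $\mathbb{S}=\{x\in\mathbb{H}:\operatorname{Re}(x)=0,\ |x|=1\}$ and $\mathbb{C}_i=\{a+ib:a,b\in\mathbb{R}\}$ for $i\in\mathbb{S}$. A quaternionic Hilbert space $\mathcal{H}$ is a right $\mathbb{H}$-vector space with a scalar product $\langle\cdot,\cdot\rangle:\mathcal{H}\times\mathcal{H}\to\mathbb{H}$ that is positive definite, right linear in the second argument, satisfies $\langle x,y\rangle=\overline{\langle y,x\rangle}$, and is complete for $\|x\|=\sqrt{\langle x,x\rangle}$. $\mathcal{B}(\mathcal{H})$ is the set of bounded right $\mathbb{H}$-linear operators, $\mathcal{B}_0(\mathcal{H})$ the set of compact ones. The adjoint is defined by $\langle T^*x,y\rangle=\langle x,Ty\rangle$; $J$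 anti-selfadjoint and unitary means $J^*=-J$ and $J^*=J^{-1}$; $[T,J]=TJ-JT$; $T$ is positive if $\langle x,Tx\rangle\ge0$ for all $x\in\mathcal{H}$. $\mathcal{H}_+^{Ji}=\{x\in\mathcal{H}:Jx=xi\}$, a complex Hilbert space over $\mathbb{C}_i$ with right scalar multiplication and the restricted scalar product. The two orthonormal sets are indexed by the same index set. For $T\in\mathcal{B}_0(\mathcal{H})$ the singular values $(\lambda_n(T))_{n\in\mathbb{N}}$ are the eigenvalues of $|T|=\sqrt{T^*T}$ (non-negative reals) in decreasing order, counted with multiplicity. For $p\in(0,+\infty)$, $S_p(J)=\{T\in\mathcal{B}_0(\mathcal{H}):[T,J]=0,\ (\lambda_n(T))_n\in\ell^p\}$ and $\|T\|_p=(\sum_n\lambda_n(T)^p)^{1/p}$ (with value $+\infty$ if the sum diverges). *)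

theory Defs
  imports "HOL-Analysis.Analysis"
begin

section \<open>Quaternions\<close>

codatatype quat = Quat (qRe: real) (qI: real) (qJ: real) (qK: real)

lemma quat_eqI [intro?]: "\<lbrakk>qRe x = qRe y; qI x = qI y; qJ x = qJ y; qK x = qK y\<rbrakk> \<Longrightarrow> x = y"
  by (rule quat.expand) simp

lemma quat_eq_iff: "x = y \<longleftrightarrow> qRe x = qRe y \<and> qI x = qI y \<and> qJ x = qJ y \<and> qK x = qK y"
  by (auto intro: quat.expand)

instantiation quat :: ab_group_add
begin

primcorec zero_quat where
  "qRe 0 = 0" | "qI 0 = 0" | "qJ 0 = 0" | "qK 0 = 0"

primcorec plus_quat where
  "qRe (x + y) = qRe x + qRe y"
| "qI (x + y) = qI x + qI y"
| "qJ (x + y) = qJ x + qJ y"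
| "qK (x + y) = qK x + qK y"

primcorec uminus_quat where
  "qRe (- x) = - qRe x" | "qI (- x) = - qI x" | "qJ (- x) = - qJ x" | "qK (- x) = - qK x"

primcorec minus_quat where
  "qRe (x - y) = qRe x - qRe y"
| "qI (x - y) = qI x - qI y"
| "qJ (x - y) = qJ x - qJ y"
| "qK (x - y) = qK x - qK y"

instance
  by standard (simp_all add: quat_eq_iff)

end

instantiation quat :: ring_1
begin

primcorec one_quat where
  "qRe 1 = 1" | "qI 1 = 0" | "qJ 1 = 0" | "qK 1 = 0"

primcorec times_quat where
  "qRe (x * y) = qRe x * qRe y - qI x * qI y - qJ x * qJ y - qK x * qK y"
| "qI (x * y) = qRe x * qI y + qI x * qRe y + qJ x * qK y - qK x * qJ y"
| "qJ (x * y) = qRe x * qJ y - qI x * qK y + qJ x * qRe y + qK x * qI y"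
| "qK (x * y) = qRe x * qK y + qI x * qJ y - qJ x * qI y + qK x * qRe y"

instance
  by standard (simp_all add: quat_eq_iff algebra_simps)

end

instantiation quat :: real_algebra_1
begin

primcorec scaleR_quat where
  "qRe (scaleR r x) = r * qRe x"
| "qI (scaleR r x) = r * qI x"
| "qJ (scaleR r x) = r * qJ x"
| "qK (scaleR r x) = r * qK x"

instance
  by standard (simp_all add: quat_eq_iff algebra_simps)

end

lemma quat_of_real_sel [simp]:
  "qRe (of_real r) = r" "qI (of_real r) = 0" "qJ (of_real r) = 0" "qK (of_real r) = 0"
  by (simp_all add: of_real_def)

primcorec qcnj :: "quat \<Rightarrow> quat" where
  "qRe (qcnj x) = qRe x" | "qI (qcnj x) = - qI x" | "qJ (qcnj x) = - qJ x" | "qK (qcnj x) = - qK x"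

instantiation quat :: real_div_algebra
begin

definition inverse_quat :: "quat \<Rightarrow> quat" where
  "inverse x = inverse ((qRe x)\<^sup>2 + (qI x)\<^sup>2 + (qJ x)\<^sup>2 + (qK x)\<^sup>2) *\<^sub>R qcnj x"

definition divide_quat :: "quat \<Rightarrow> quat \<Rightarrow> quat" where
  "divide_quat x y = x * inverse y"

instance
proof
  fix x y :: quat
  show "inverse x * x = 1" "x * inverse x = 1" if "x \<noteq> 0"
  proof -
    define N where "N = (qRe x)\<^sup>2 + (qI x)\<^sup>2 + (qJ x)\<^sup>2 + (qK x)\<^sup>2"
    have "N \<noteq> 0"
      using that unfolding N_def quat_eq_iff
      by (simp add: add_nonneg_eq_0_iff)
    moreover have "qcnj x * x = N *\<^sub>R 1" "x * qcnj x = N *\<^sub>R 1"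
      by (simp_all add: quat_eq_iff N_def power2_eq_square algebra_simps)
    ultimately show "inverse x * x = 1" "x * inverse x = 1"
      by (simp_all add: inverse_quat_def N_def[symmetric])
  qed
  show "x div y = x * inverse y" by (fact divide_quat_def)
  show "inverse (0::quat) = 0" by (simp add: inverse_quat_def quat_eq_iff)
qed

end

instantiation quat :: real_inner
begin

definition inner_quat :: "quat \<Rightarrow> quat \<Rightarrow> real" where
  "inner_quat x y = qRe x * qRe y + qI x * qI y + qJ x * qJ y + qK x * qK y"

definition norm_quat :: "quat \<Rightarrow> real" where
  "norm_quat x = sqrt ((qRe x)\<^sup>2 + (qI x)\<^sup>2 + (qJ x)\<^sup>2 + (qK x)\<^sup>2)"

definition sgn_quat :: "quat \<Rightarrow> quat" where
  "sgn_quat x = x /\<^sub>R norm x"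

definition dist_quat :: "quat \<Rightarrow> quat \<Rightarrow> real" where
  "dist_quat x y = norm (x - y)"

definition uniformity_quat :: "(quat \<times> quat) filter" where [code del]:
  "uniformity_quat = (INF e\<in>{0 <..}. principal {(x, y). dist x y < e})"

definition open_quat :: "quat set \<Rightarrow> bool" where [code del]:
  "open_quat U \<longleftrightarrow> (\<forall>x\<in>U. eventually (\<lambda>(x', y). x' = x \<longrightarrow> y \<in> U) uniformity)"

instance
proof
  fix x y z :: quat and r :: real and U :: "quat set"
  show "sgn x = x /\<^sub>R norm x" by (fact sgn_quat_def)
  show "dist x y = norm (x - y)" by (fact dist_quat_def)
  show "(uniformity :: (quat \<times> quat) filter) = (INF e\<in>{0 <..}. principal {(x, y). dist x y < e})"
    by (fact uniformity_quat_def)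
  show "open U = (\<forall>x\<in>U. \<forall>\<^sub>F (x', y) in uniformity. x' = x \<longrightarrow> y \<in> U)"
    by (fact open_quat_def)
  show "inner x y = inner y x" "inner (x + y) z = inner x z + inner y z"
    "inner (r *\<^sub>R x) y = r * inner x y"
    by (simp_all add: inner_quat_def algebra_simps)
  show "0 \<le> inner x x" by (simp add: inner_quat_def)
  show "inner x x = 0 \<longleftrightarrow> x = 0"
    by (simp add: inner_quat_def quat_eq_iff add_nonneg_eq_0_iff flip: power2_eq_square)
  show "norm x = sqrt (inner x x)"
    by (simp add: inner_quat_def norm_quat_def power2_eq_square)
qed

end

lemma norm_quat_power2: "(norm x)\<^sup>2 = (qRe x)\<^sup>2 + (qI x)\<^sup>2 + (qJ x)\<^sup>2 + (qK x)\<^sup>2"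
  for x :: quat
  by (simp add: norm_quat_def)

instance quat :: real_normed_div_algebra
proof
  fix x y :: quat
  have "(norm (x * y))\<^sup>2 = (norm x * norm y)\<^sup>2"
    unfolding power_mult_distrib norm_quat_power2
    by (simp add: power2_eq_square algebra_simps)
  then show "norm (x * y) = norm x * norm y"
    by (metis norm_ge_zero mult_nonneg_nonneg power2_eq_imp_eq)
qed

definition imaginary_unit_sphere :: "quat set"  (\<open>\<S>\<close>) where
  "\<S> = {q. qRe q = 0 \<and> norm q = 1}"


section \<open>Quaternionic Hilbert spaces\<close>

text \<open>
  The norm, the real scalar multiplication and the real inner product inherited from
  \<^class>\<open>real_inner\<close> are no additional data: they are determined by the quaternionic scalar
  multiplication and scalar product through the axioms \<open>qscale_of_real\<close> and
  \<open>inner_eq_qRe_qinner\<close>. Positive definiteness of \<open>qinner\<close> and the formula for the norm are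
  derived below.
\<close>

class quaternionic_hilbert_space = real_inner + complete_space +
  fixes qscale :: "'a \<Rightarrow> quat \<Rightarrow> 'a"  (infixl \<open>\<cdot>\<^sub>Q\<close> 75)
    and qinner :: "'a \<Rightarrow> 'a \<Rightarrow> quat"
  assumes qscale_add_left: "(x + y) \<cdot>\<^sub>Q a = x \<cdot>\<^sub>Q a + y \<cdot>\<^sub>Q a"
    and qscale_add_right: "x \<cdot>\<^sub>Q (a + b) = x \<cdot>\<^sub>Q a + x \<cdot>\<^sub>Q b"
    and qscale_qscale: "x \<cdot>\<^sub>Q a \<cdot>\<^sub>Q b = x \<cdot>\<^sub>Q (a * b)"
    and qscale_of_real: "x \<cdot>\<^sub>Q of_real r = r *\<^sub>R x"
    and qinner_add_right: "qinner x (y + z) = qinner x y + qinner x z"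
    and qinner_qscale_right: "qinner x (y \<cdot>\<^sub>Q a) = qinner x y * a"
    and qinner_commute: "qinner x y = qcnj (qinner y x)"
    and inner_eq_qRe_qinner: "inner x y = qRe (qinner x y)"

lemma qscale_one: "x \<cdot>\<^sub>Q 1 = x"
  for x :: "'h::quaternionic_hilbert_space"
  using qscale_of_real[of x 1] by simp

lemma qinner_self: "qinner x x = of_real ((norm x)\<^sup>2)"
  for x :: "'h::quaternionic_hilbert_space"
proof (rule quat_eqI)
  have *: "qinner x x = qcnj (qinner x x)"
    by (rule qinner_commute)
  show "qRe (qinner x x) = qRe (of_real ((norm x)\<^sup>2))"
    by (simp only: quat_of_real_sel power2_norm_eq_inner inner_eq_qRe_qinner)
  show "qI (qinner x x) = qI (of_real ((norm x)\<^sup>2))"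
    using arg_cong[OF *, of qI] by (simp only: quat_of_real_sel qcnj.sel)
  show "qJ (qinner x x) = qJ (of_real ((norm x)\<^sup>2))"
    using arg_cong[OF *, of qJ] by (simp only: quat_of_real_sel qcnj.sel)
  show "qK (qinner x x) = qK (of_real ((norm x)\<^sup>2))"
    using arg_cong[OF *, of qK] by (simp only: quat_of_real_sel qcnj.sel)
qed

lemma norm_eq_sqrt_qinner: "norm x = sqrt (qRe (qinner x x))"
  for x :: "'h::quaternionic_hilbert_space"
  unfolding qinner_self quat_of_real_sel by simp

lemma qinner_self_eq_zero_iff: "qinner x x = 0 \<longleftrightarrow> x = 0"
  for x :: "'h::quaternionic_hilbert_space"
  unfolding qinner_self by simp

text \<open>The quaternions themselves, with right multiplication, as a sanity check of the axioms.\<close>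

instance quat :: complete_space
proof
  fix X :: "nat \<Rightarrow> quat"
  assume X: "Cauchy X"
  have comp: "convergent (\<lambda>n. f (X n))"
    if f: "\<And>x y. f (x - y) = f x - f y" "\<And>x. (f x)\<^sup>2 \<le> (norm x)\<^sup>2" for f :: "quat \<Rightarrow> real"
  proof -
    have le: "\<bar>f x\<bar> \<le> norm x" for x
      using f(2)[of x] power2_le_iff_abs_le[OF norm_ge_zero[of x], of "f x"] by blast
    have "Cauchy (\<lambda>n. f (X n))"
      unfolding Cauchy_def dist_norm real_norm_def f(1)[symmetric]
      using X[unfolded Cauchy_def dist_norm] le by (meson le_less_trans)
    then show ?thesis by (rule Cauchy_convergent)
  qed
  obtain a b c d where lim: "(\<lambda>n. qRe (X n)) \<longlonglongrightarrow> a" "(\<lambda>n. qI (X n)) \<longlonglongrightarrow> b"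
      "(\<lambda>n. qJ (X n)) \<longlonglongrightarrow> c" "(\<lambda>n. qK (X n)) \<longlonglongrightarrow> d"
    using comp[of qRe] comp[of qI] comp[of qJ] comp[of qK]
    by (auto simp: convergent_def norm_quat_power2)
  have "(\<lambda>n. sqrt ((qRe (X n) - a)\<^sup>2 + (qI (X n) - b)\<^sup>2 + (qJ (X n) - c)\<^sup>2 + (qK (X n) - d)\<^sup>2))
      \<longlonglongrightarrow> sqrt ((a - a)\<^sup>2 + (b - b)\<^sup>2 + (c - c)\<^sup>2 + (d - d)\<^sup>2)"
    by (intro tendsto_intros lim)
  then have "(\<lambda>n. dist (X n) (Quat a b c d)) \<longlonglongrightarrow> 0"
    by (simp add: dist_quat_def norm_quat_def)
  then show "convergent X"
    unfolding convergent_def by (subst tendsto_dist_iff) blast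
qed

instantiation quat :: quaternionic_hilbert_space
begin

definition qscale_quat :: "quat \<Rightarrow> quat \<Rightarrow> quat" where "qscale_quat x a = x * a"

definition qinner_quat :: "quat \<Rightarrow> quat \<Rightarrow> quat" where "qinner_quat x y = qcnj x * y"

instance
  by standard
    (simp_all add: qscale_quat_def qinner_quat_def inner_quat_def quat_eq_iff algebra_simps)

end

definition qorthonormal_on :: "nat set \<Rightarrow> (nat \<Rightarrow> 'h::quaternionic_hilbert_space) \<Rightarrow> bool" where
  "qorthonormal_on N e \<longleftrightarrow> (\<forall>m\<in>N. \<forall>n\<in>N. qinner (e m) (e n) = (if m = n then 1 else 0))"

subsection \<open>Dimension of right quaternionic subspaces\<close>

text \<open>
  The library's span, independence and dimension are developed over fields only; these are
  the same definitions for right linear combinations.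
\<close>

definition qspan :: "'h::quaternionic_hilbert_space set \<Rightarrow> 'h set" where
  "qspan B = {\<Sum>b\<in>F. b \<cdot>\<^sub>Q c b | F c. finite F \<and> F \<subseteq> B}"

definition qindependent :: "'h::quaternionic_hilbert_space set \<Rightarrow> bool" where
  "qindependent B \<longleftrightarrow>
    (\<forall>F c. finite F \<longrightarrow> F \<subseteq> B \<longrightarrow> (\<Sum>b\<in>F. b \<cdot>\<^sub>Q c b) = 0 \<longrightarrow> (\<forall>b\<in>F. c b = 0))"

text \<open>As with \<^const>\<open>card\<close>, the value is 0 for infinite-dimensional subspaces.\<close>

definition qdim :: "'h::quaternionic_hilbert_space set \<Rightarrow> nat" where
  "qdim V = card (SOME B. B \<subseteq> V \<and> qindependent B \<and> V \<subseteq> qspan B)"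


section \<open>Operators\<close>

definition qbounded_ops :: "('h::quaternionic_hilbert_space \<Rightarrow> 'h) set"  (\<open>\<B>\<close>) where
  "\<B> = {T. (\<forall>x y. T (x + y) = T x + T y) \<and> (\<forall>x a. T (x \<cdot>\<^sub>Q a) = T x \<cdot>\<^sub>Q a) \<and>
            (\<exists>K. \<forall>x. norm (T x) \<le> norm x * K)}"

definition qcompact_ops :: "('h::quaternionic_hilbert_space \<Rightarrow> 'h) set"  (\<open>\<B>\<^sub>0\<close>) where
  "\<B>\<^sub>0 = {T \<in> \<B>. \<forall>S. bounded S \<longrightarrow> compact (closure (T ` S))}"

definition qadjoint :: "('h::quaternionic_hilbert_space \<Rightarrow> 'h) \<Rightarrow> 'h \<Rightarrow> 'h" where
  "qadjoint T = (THE S. \<forall>x y. qinner (S x) y = qinner x (T y))"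

definition anti_selfadjoint :: "('h::quaternionic_hilbert_space \<Rightarrow> 'h) \<Rightarrow> bool" where
  "anti_selfadjoint T \<longleftrightarrow> qadjoint T = (\<lambda>x. - T x)"

definition qunitary :: "('h::quaternionic_hilbert_space \<Rightarrow> 'h) \<Rightarrow> bool" where
  "qunitary T \<longleftrightarrow> qadjoint T \<circ> T = id \<and> T \<circ> qadjoint T = id"

definition op_commutator ::
    "('h::quaternionic_hilbert_space \<Rightarrow> 'h) \<Rightarrow> ('h \<Rightarrow> 'h) \<Rightarrow> 'h \<Rightarrow> 'h" where
  "op_commutator T J = (\<lambda>x. T (J x) - J (T x))"

definition qpositive :: "('h::quaternionic_hilbert_space \<Rightarrow> 'h) \<Rightarrow> bool" where
  "qpositive T \<longleftrightarrow> (\<forall>x. \<exists>r\<ge>0. qinner x (T x) = of_real r)"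

definition op_sqrt :: "('h::quaternionic_hilbert_space \<Rightarrow> 'h) \<Rightarrow> 'h \<Rightarrow> 'h" where
  "op_sqrt A = (THE S. S \<in> \<B> \<and> qpositive S \<and> S \<circ> S = A)"

definition op_abs :: "('h::quaternionic_hilbert_space \<Rightarrow> 'h) \<Rightarrow> 'h \<Rightarrow> 'h" where
  "op_abs T = op_sqrt (qadjoint T \<circ> T)"

definition H_plus :: "('h::quaternionic_hilbert_space \<Rightarrow> 'h) \<Rightarrow> quat \<Rightarrow> 'h set" where
  "H_plus J i = {x. J x = x \<cdot>\<^sub>Q i}"


section \<open>Singular values and Schatten classes\<close>

definition qeigenspace :: "('h::quaternionic_hilbert_space \<Rightarrow> 'h) \<Rightarrow> real \<Rightarrow> 'h set" where
  "qeigenspace A r = {x. A x = x \<cdot>\<^sub>Q of_real r}"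

text \<open>
  The decreasing enumeration of the eigenvalues of the absolute value of \<open>T\<close> in which every
  positive eigenvalue occurs as often as the quaternionic dimension of its eigenspace. If there
  are only finitely many positive eigenvalues, the sequence continues with zeros; if there
  are infinitely many, the eigenvalue 0 is never reached and does not occur.
  The condition determines the sequence uniquely, and for compact \<open>T\<close> it is satisfiable.
\<close>

definition singular_values :: "('h::quaternionic_hilbert_space \<Rightarrow> 'h) \<Rightarrow> nat \<Rightarrow> real" where
  "singular_values T = (THE s. decseq s \<and> (\<forall>n. 0 \<le> s n) \<and>
     (\<forall>r>0. finite {n. s n = r} \<and> card {n. s n = r} = qdim (qeigenspace (op_abs T) r)))"

definition schatten_class ::
    "real \<Rightarrow> ('h::quaternionic_hilbert_space \<Rightarrow> 'h) \<Rightarrow> ('h \<Rightarrow> 'h) set" where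
  "schatten_class p J = {T \<in> \<B>\<^sub>0. op_commutator T J = (\<lambda>x. 0) \<and>
     summable (\<lambda>n. singular_values T n powr p)}"

definition ennreal_root :: "real \<Rightarrow> ennreal \<Rightarrow> ennreal" where
  "ennreal_root p x = (if x = \<infinity> then \<infinity> else ennreal (enn2real x powr (1 / p)))"

definition schatten_norm :: "real \<Rightarrow> ('h::quaternionic_hilbert_space \<Rightarrow> 'h) \<Rightarrow> ennreal" where
  "schatten_norm p T = ennreal_root p (\<Sum>n. ennreal (singular_values T n powr p))"

text \<open>
  Pairs of orthonormal sets \<open>{e\<^sub>n}\<close>, \<open>{\<sigma>\<^sub>n}\<close> in \<open>H_plus J i\<close>, written as families over a common
  index set \<open>N\<close> of natural numbers, finite or infinite (in a separable space every
  orthonormal set is countable).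
\<close>

definition orthonormal_pairs ::
    "('h::quaternionic_hilbert_space \<Rightarrow> 'h) \<Rightarrow> quat
      \<Rightarrow> (nat set \<times> (nat \<Rightarrow> 'h) \<times> (nat \<Rightarrow> 'h)) set" where
  "orthonormal_pairs J i = {(N, e, \<sigma>). e ` N \<subseteq> H_plus J i \<and> \<sigma> ` N \<subseteq> H_plus J i \<and>
     qorthonormal_on N e \<and> qorthonormal_on N \<sigma>}"

end

(*
  For compact T commuting with J, a greedy choice of unit eigenvectors e_k of T*T, each maximising
  |T x| on the orthogonal complement of the previous ones, can be made inside H_plus J i: the
  eigenspaces are J-invariant and every vector y splits as y_+ + y_- with y_+ and y_- j in
  H_plus J i. With s_k = |T e_k| this gives |T| x = sum_k e_k s_k <e_k, x>, so the s_k are the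
  singular values of T. For orthonormal families sigma, u the matrix |<sigma_n, f_k>| |<e_k, u_n>|,
  f_k = T e_k / s_k, has row and column sums at most 1, and convexity of t^p yields
  sum_n |<sigma_n, T u_n>|^p <= sum_k s_k^p; equality holds for sigma = f and u = e.
*)

theory Submission
  imports Defs
begin

section \<open>Quaternionic scalar products\<close>

text \<open>The adjoint, the positive square root, the dimension and the sequence of singular values
  are all given by \<open>THE\<close> or \<open>SOME\<close>, so a diagonalisation of
  \<open>T\<close> says nothing about them until each is shown to be unique. The adjoint is pinned
  down by nondegeneracy of the scalar product, the square root by its action on the
  \<open>e k\<close>, the dimension by counting real dimensions, and the sequence by counting the
  indices above each positive level. Existence proofs are carried out in the underlying real Hilbert
  space. Nothing is lost by this: the real parts of \<open>q * a\<close>, for all quaternions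
  \<open>a\<close>, determine \<open>q\<close>, so right linearity turns identities for
  \<open>inner\<close> into identities for \<open>qinner\<close>. The passage to
  \<open>H_plus J i\<close> takes place only inside a single eigenspace, by means of a quaternion
  that anticommutes with \<open>i\<close>.\<close>

instance quaternionic_hilbert_space \<subseteq> banach ..

declare of_real_power [simp del]

lemma quat_of_real_commute: "of_real r * a = a * (of_real r :: quat)"
  and scaleR_quat_right: "r *\<^sub>R a = a * (of_real r :: quat)"
  by (simp_all add: quat_eq_iff)

lemma qcnj_simps [simp]:
  "qcnj 0 = 0" "qcnj 1 = 1" "qcnj (of_real r) = of_real r" "qcnj (qcnj x) = x" "norm (qcnj x) = norm x"
  by (simp_all add: quat_eq_iff norm_quat_def)

lemma qcnj_add: "qcnj (x + y) = qcnj x + qcnj y"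
  and qcnj_mult: "qcnj (x * y) = qcnj y * qcnj x"
  by (simp_all add: quat_eq_iff algebra_simps)

lemma qcnj_mult_self: "qcnj x * x = of_real ((norm x)\<^sup>2)"
  and mult_qcnj_self: "x * qcnj x = of_real ((norm x)\<^sup>2)"
  by (simp_all only: norm_quat_power2)
    (simp_all add: quat_eq_iff power2_eq_square algebra_simps del: of_real_add of_real_mult)

text \<open>The choice \<open>a = 1\<close> makes \<open>d\<close> real, and then an imaginary unit
  \<open>a\<close> makes \<open>d * a\<close> both real and purely imaginary. This closes the
  polarisation argument for positive operators.\<close>

lemma quat_eq_0_if_all_multiples_real:
  fixes d :: quat
  assumes "\<And>a. d * a = qcnj (d * a)"
  shows "d = 0"
  using assms[of 1] assms[of "Quat 0 1 0 0"] assms[of "Quat 0 0 1 0"]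
  by (simp add: quat_eq_iff)

lemma imaginary_unit_square:
  assumes "i \<in> \<S>"
  shows "i * i = - 1"
proof -
  have "qRe i = 0" and n: "(norm i)\<^sup>2 = 1"
    using assms by (simp_all add: imaginary_unit_sphere_def)
  then have "(qI i)\<^sup>2 + (qJ i)\<^sup>2 + (qK i)\<^sup>2 = 1"
    using norm_quat_power2[of i] by simp
  then show ?thesis
    using \<open>qRe i = 0\<close> by (simp add: quat_eq_iff power2_eq_square)
qed

text \<open>Purely imaginary quaternions anticommute when they are orthogonal as vectors of real
  3-space. The vector with coordinates \<open>(qJ i, - qI i, 0)\<close> is orthogonal to
  \<open>i\<close>; it vanishes only if \<open>i\<close> lies on the third axis, and then the first
  axis serves.\<close>

lemma imaginary_anticommuting:
  assumes "i \<in> \<S>"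
  obtains j where "j \<noteq> 0" "i * j = - (j * i)"
proof (cases "qI i = 0 \<and> qJ i = 0")
  case True
  with assms have "i * Quat 0 1 0 0 = - (Quat 0 1 0 0 * i)"
    by (simp add: quat_eq_iff imaginary_unit_sphere_def)
  then show ?thesis by (intro that[of "Quat 0 1 0 0"]) (auto simp: quat_eq_iff)
next
  case False
  with assms have "i * Quat 0 (qJ i) (- qI i) 0 = - (Quat 0 (qJ i) (- qI i) 0 * i)"
    by (simp add: quat_eq_iff imaginary_unit_sphere_def)
  with False show ?thesis by (intro that[of "Quat 0 (qJ i) (- qI i) 0"]) (auto simp: quat_eq_iff)
qed

lemma qinner_add_left: "qinner (x + y) z = qinner x z + qinner y z"
  by (subst (1 2 3) qinner_commute) (simp add: qinner_add_right qcnj_add)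

lemma qinner_qscale_left: "qinner (x \<cdot>\<^sub>Q a) y = qcnj a * qinner x y"
  by (subst (1 2) qinner_commute) (simp add: qinner_qscale_right qcnj_mult)

lemma qinner_scaleR_right: "qinner x (r *\<^sub>R y) = r *\<^sub>R qinner x y"
  by (metis qinner_qscale_right qscale_of_real scaleR_quat_right)

lemma qinner_scaleR_left: "qinner (r *\<^sub>R x) y = r *\<^sub>R qinner x y"
  by (metis qcnj_simps(3) qinner_qscale_left qscale_of_real scaleR_conv_of_real)

lemma norm_qscale: "norm (x \<cdot>\<^sub>Q a) = norm x * norm a"
proof -
  have "qinner (x \<cdot>\<^sub>Q a) (x \<cdot>\<^sub>Q a) = qcnj a * of_real ((norm x)\<^sup>2) * a"
    unfolding qinner_qscale_left qinner_qscale_right by (simp add: qinner_self mult.assoc)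
  also have "\<dots> = of_real ((norm x)\<^sup>2) * (qcnj a * a)"
    by (metis quat_of_real_commute mult.assoc)
  also have "\<dots> = of_real ((norm x * norm a)\<^sup>2)"
    by (simp add: qcnj_mult_self power_mult_distrib)
  finally have "(norm (x \<cdot>\<^sub>Q a))\<^sup>2 = (norm x * norm a)\<^sup>2"
    unfolding qinner_self by (simp only: of_real_eq_iff)
  then show ?thesis by (simp add: power2_eq_iff_nonneg)
qed

text \<open>The unit quaternion \<open>a\<close> rotates the value \<open>q\<close> of the product
  to the positive real number \<open>norm q\<close>, so that the real Cauchy-Schwarz inequality
  applies to \<open>x\<close> and \<open>y \<cdot>\<^sub>Q a\<close>.\<close>

lemma qinner_cauchy_schwarz:
  fixes x y :: "'h::quaternionic_hilbert_space"
  shows "norm (qinner x y) \<le> norm x * norm y"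
proof (cases "qinner x y = 0")
  case False
  define q where "q = qinner x y"
  define a where "a = qcnj q * of_real (1 / norm q)"
  have "qinner x (y \<cdot>\<^sub>Q a) = of_real ((norm q)\<^sup>2) * of_real (1 / norm q)"
    by (simp only: qinner_qscale_right a_def q_def[symmetric] mult_qcnj_self flip: mult.assoc)
  also have "\<dots> = of_real (norm q)"
    using False unfolding of_real_mult[symmetric] by (simp add: q_def power2_eq_square)
  finally have "norm q = inner x (y \<cdot>\<^sub>Q a)"
    by (simp add: inner_eq_qRe_qinner)
  also have "\<dots> \<le> norm x * norm (y \<cdot>\<^sub>Q a)"
    by (rule norm_cauchy_schwarz)
  also have "norm a = 1"
    using False unfolding a_def norm_mult norm_of_real by (simp add: q_def)
  then have "norm (y \<cdot>\<^sub>Q a) = norm y" by (simp add: norm_qscale)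
  finally show ?thesis by (simp add: q_def)
qed simp

text \<open>Multiplying by the four basis quaternions moves each component, up to sign, into the
  real part.\<close>

lemma qinner_eqI:
  fixes x y x' y' :: "'h::quaternionic_hilbert_space"
  assumes "\<And>a. inner x (y \<cdot>\<^sub>Q a) = inner x' (y' \<cdot>\<^sub>Q a)"
  shows "qinner x y = qinner x' y'"
  using assms[of 1] assms[of "Quat 0 1 0 0"] assms[of "Quat 0 0 1 0"] assms[of "Quat 0 0 0 1"]
  by (simp add: inner_eq_qRe_qinner qinner_qscale_right quat_eq_iff)

lemma bounded_linear_qinner_right: "bounded_linear (qinner x)"
  by (rule bounded_linear_intro[where K = "norm x"])
    (use qinner_cauchy_schwarz[of x] in
      \<open>auto simp: qinner_add_right qinner_scaleR_right mult.commute\<close>)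

lemma bounded_linear_qinner_left: "bounded_linear (\<lambda>x. qinner x y)"
  by (rule bounded_linear_intro[where K = "norm y"])
    (use qinner_cauchy_schwarz in \<open>auto simp: qinner_add_left qinner_scaleR_left\<close>)

lemma bounded_linear_qscale_right: "bounded_linear (\<lambda>a. x \<cdot>\<^sub>Q a)"
proof (rule bounded_linear_intro[where K = "norm x"])
  show "x \<cdot>\<^sub>Q (r *\<^sub>R a) = r *\<^sub>R (x \<cdot>\<^sub>Q a)" for r a
    by (simp only: scaleR_quat_right flip: qscale_of_real[of "x \<cdot>\<^sub>Q a" r] qscale_qscale)
qed (simp_all add: qscale_add_right norm_qscale mult.commute)

lemma bounded_linear_qscale_left: "bounded_linear (\<lambda>x. x \<cdot>\<^sub>Q a)"
proof (rule bounded_linear_intro[where K = "norm a"])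
  show "(r *\<^sub>R x) \<cdot>\<^sub>Q a = r *\<^sub>R (x \<cdot>\<^sub>Q a)" for r x
    by (metis qscale_of_real qscale_qscale quat_of_real_commute)
qed (simp_all add: qscale_add_left norm_qscale)

lemmas qinner_zero_right [simp] = linear_0[OF bounded_linear.linear[OF bounded_linear_qinner_right]]
  and qinner_zero_left [simp] = linear_0[OF bounded_linear.linear[OF bounded_linear_qinner_left]]
  and qscale_zero_right [simp] = linear_0[OF bounded_linear.linear[OF bounded_linear_qscale_right]]
  and qscale_zero_left [simp] = linear_0[OF bounded_linear.linear[OF bounded_linear_qscale_left]]
  and qinner_diff_right = linear_diff[OF bounded_linear.linear[OF bounded_linear_qinner_right]]
  and qinner_diff_left = linear_diff[OF bounded_linear.linear[OF bounded_linear_qinner_left]]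
  and qinner_minus_right = linear_neg[OF bounded_linear.linear[OF bounded_linear_qinner_right]]
  and qinner_minus_left = linear_neg[OF bounded_linear.linear[OF bounded_linear_qinner_left]]
  and qinner_sum_right = linear_sum[OF bounded_linear.linear[OF bounded_linear_qinner_right]]
  and qinner_sum_left = linear_sum[OF bounded_linear.linear[OF bounded_linear_qinner_left]]
  and qscale_minus_right = linear_neg[OF bounded_linear.linear[OF bounded_linear_qscale_right]]

lemma qinner_zero_commute: "qinner x y = 0 \<longleftrightarrow> qinner y x = 0"
  by (metis qinner_commute qcnj_simps(1))

lemma eqI_qinner_left:
  fixes x y :: "'h::quaternionic_hilbert_space"
  assumes "\<And>z. qinner x z = qinner y z"
  shows "x = y"
  using assms[of "x - y"] qinner_self_eq_zero_iff[of "x - y"] by (simp add: qinner_diff_left)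

text \<open>With \<open>y\<close> the sum of the \<open>e n \<cdot>\<^sub>Q c n\<close>, norms at
  most 1 give (norm y)^2 \<le> \<open>inner y x\<close>, and expanding the square of
  \<open>norm (x - y)\<close> does the rest. Allowing norms below 1 admits the zero vectors that pad
  a singular system.\<close>

lemma bessel_inequality:
  fixes e :: "nat \<Rightarrow> 'h::quaternionic_hilbert_space"
  assumes fin: "finite F"
    and orth: "\<And>m n. m \<in> F \<Longrightarrow> n \<in> F \<Longrightarrow> m \<noteq> n \<Longrightarrow> qinner (e m) (e n) = 0"
    and le1: "\<And>n. n \<in> F \<Longrightarrow> norm (e n) \<le> 1"
  shows "(\<Sum>n\<in>F. (norm (qinner (e n) x))\<^sup>2) \<le> (norm x)\<^sup>2"
proof -
  define c where "c n = qinner (e n) x" for n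
  define y where "y = (\<Sum>n\<in>F. e n \<cdot>\<^sub>Q c n)"
  have xy: "qinner y x = of_real (\<Sum>n\<in>F. (norm (c n))\<^sup>2)"
    by (simp add: y_def qinner_sum_left qinner_qscale_left c_def qcnj_mult_self)
  have ey: "qinner (e n) y = of_real ((norm (e n))\<^sup>2) * c n" if "n \<in> F" for n
  proof -
    have "qinner (e n) y = (\<Sum>m\<in>F. if m = n then qinner (e n) (e n) * c n else 0)"
      unfolding y_def qinner_sum_right using that orth
      by (intro sum.cong) (auto simp: qinner_qscale_right)
    then show ?thesis using fin that by (simp add: qinner_self)
  qed
  have "qinner y y = (\<Sum>n\<in>F. qcnj (c n) * qinner (e n) y)"
    by (subst (1) y_def) (simp add: qinner_sum_left qinner_qscale_left)
  also have "\<dots> = (\<Sum>n\<in>F. of_real ((norm (e n))\<^sup>2 * (norm (c n))\<^sup>2))"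
  proof (intro sum.cong refl)
    fix n assume "n \<in> F"
    then have "qcnj (c n) * qinner (e n) y = of_real ((norm (e n))\<^sup>2) * (qcnj (c n) * c n)"
      by (metis ey quat_of_real_commute mult.assoc)
    then show "qcnj (c n) * qinner (e n) y = of_real ((norm (e n))\<^sup>2 * (norm (c n))\<^sup>2)"
      by (simp only: qcnj_mult_self of_real_mult)
  qed
  finally have yy: "(norm y)\<^sup>2 = (\<Sum>n\<in>F. (norm (e n))\<^sup>2 * (norm (c n))\<^sup>2)"
    unfolding qinner_self by (simp only: of_real_eq_iff flip: of_real_sum)
  also have "\<dots> \<le> (\<Sum>n\<in>F. (norm (c n))\<^sup>2)"
    using le1 by (intro sum_mono mult_left_le_one_le) (auto simp: power_le_one)
  finally have "(norm y)\<^sup>2 \<le> (\<Sum>n\<in>F. (norm (c n))\<^sup>2)" .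
  moreover have "inner y x = (\<Sum>n\<in>F. (norm (c n))\<^sup>2)"
    by (simp add: inner_eq_qRe_qinner xy del: of_real_sum)
  moreover have "0 \<le> (norm x)\<^sup>2 - 2 * inner y x + (norm y)\<^sup>2"
    using inner_ge_zero[of "x - y"]
    by (simp add: inner_diff inner_commute power2_norm_eq_inner algebra_simps)
  ultimately show ?thesis by (simp add: c_def)
qed

section \<open>Adjoints\<close>

text \<open>The representing vector minimises \<open>\<parallel>x\<parallel>\<^sup>2 - 2 f x\<close>; minimising sequences are Cauchy by
  the parallelogram law.\<close>

lemma riesz_representation:
  fixes f :: "'h::{real_inner, complete_space} \<Rightarrow> real"
  assumes "bounded_linear f"
  shows "\<exists>z. \<forall>y. f y = inner z y"
proof -
  interpret bounded_linear f by fact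
  define q where "q x = (norm x)\<^sup>2 - 2 * f x" for x
  define m where "m = Inf (range q)"
  obtain K where K: "\<And>x. norm (f x) \<le> norm x * K" using bounded by blast
  have bdd: "bdd_below (range q)"
  proof (rule bdd_belowI2)
    fix x :: 'h
    have "0 \<le> (norm x - K)\<^sup>2" by simp
    moreover have "f x \<le> norm x * K" using K[of x] by simp
    ultimately show "- K\<^sup>2 \<le> q x"
      by (simp add: q_def power2_diff mult.commute)
  qed
  have m_le: "m \<le> q x" for x
    unfolding m_def by (rule cInf_lower[OF _ bdd]) simp
  have "\<exists>x. q x < m + inverse (real (Suc n))" for n
    using cInf_lessD[of "range q" "m + inverse (real (Suc n))"] by (auto simp: m_def)
  then obtain X where X: "\<And>n. q (X n) < m + inverse (real (Suc n))" by metis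
  have para: "(norm (x - y))\<^sup>2 \<le> 2 * (q x + q y - 2 * m)" for x y
  proof -
    have "(norm (x - y))\<^sup>2 = 2 * (q x + q y - 2 * q ((1/2) *\<^sub>R (x + y)))"
      unfolding q_def power2_norm_eq_inner
      by (simp add: scaleR add inner_add inner_diff algebra_simps inner_commute)
    with m_le[of "(1/2) *\<^sub>R (x + y)"] show ?thesis by simp
  qed
  have "Cauchy X"
  proof (rule metric_CauchyI)
    fix \<epsilon> :: real assume "0 < \<epsilon>"
    \<comment> \<open>Both values of \<open>q\<close> exceed \<open>m\<close> by less than
      \<open>h N\<close>, so \<open>para\<close> bounds the squared distance by
      \<open>4 * h N\<close>; hence the quarter.\<close>
    then obtain N where N: "inverse (real (Suc N)) < \<epsilon>\<^sup>2 / 4"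
      using reals_Archimedean[of "\<epsilon>\<^sup>2 / 4"] by auto
    define h where "h n = inverse (real (Suc n))" for n
    have "dist (X a) (X b) < \<epsilon>" if "a \<ge> N" "b \<ge> N" for a b
    proof -
      have le: "h n \<le> h N" if "n \<ge> N" for n
        using that by (simp add: h_def field_simps)
      have "(norm (X a - X b))\<^sup>2 < \<epsilon>\<^sup>2"
        using para[of "X a" "X b"] X[of a, folded h_def] X[of b, folded h_def] N[folded h_def]
          le[OF that(1)] le[OF that(2)] by argo
      then show ?thesis
        using \<open>0 < \<epsilon>\<close> by (simp add: dist_norm power2_less_imp_less)
    qed
    then show "\<exists>N. \<forall>a\<ge>N. \<forall>b\<ge>N. dist (X a) (X b) < \<epsilon>" by blast
  qed
  then obtain z where z: "X \<longlonglongrightarrow> z" using Cauchy_convergent convergent_def by metis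
  have "(\<lambda>n. q (X n)) \<longlonglongrightarrow> q z"
    unfolding q_def by (intro tendsto_intros z tendsto)
  moreover have "(\<lambda>n. m + inverse (real (Suc n))) \<longlonglongrightarrow> m + 0"
    by (intro tendsto_intros LIMSEQ_inverse_real_of_nat)
  ultimately have qz: "q z \<le> m"
    using X by (intro LIMSEQ_le[where X = "\<lambda>n. q (X n)"]) (auto intro: less_imp_le)
  have "f y = inner z y" for y
  proof -
    define d where "d = inner z y - f y"
    \<comment> \<open>Minimality of \<open>z\<close> makes 2 t d + t^2 (norm y)^2 nonnegative for
      every t. The chosen \<open>t\<close> minimises 2 t d + t^2 s, with minimum - d^2 / s; the
      added 1 keeps \<open>s\<close> positive for \<open>y = 0\<close>.\<close>
    define s where "s = (norm y)\<^sup>2 + 1"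
    define t where "t = - d / s"
    have s: "s > 0" by (simp add: s_def add_nonneg_pos)
    have "q (z + t *\<^sub>R y) = q z + 2 * t * d + t\<^sup>2 * (norm y)\<^sup>2"
      unfolding q_def power2_norm_eq_inner d_def
      by (simp add: add scaleR inner_add inner_commute algebra_simps power2_eq_square)
    then have "0 \<le> 2 * t * d + t\<^sup>2 * (norm y)\<^sup>2"
      using m_le[of "z + t *\<^sub>R y"] qz by simp
    also have "\<dots> \<le> 2 * t * d + t\<^sup>2 * s"
      by (simp add: s_def mult_left_mono)
    also have "\<dots> = - (d\<^sup>2 / s)"
      using s by (simp add: t_def field_simps power2_eq_square)
    finally have "d\<^sup>2 / s \<le> 0" by simp
    then have "d = 0" using s by (simp add: divide_le_0_iff)
    then show ?thesis by (simp add: d_def)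
  qed
  then show ?thesis by blast
qed

lemma qbounded_opsD:
  assumes "T \<in> \<B>"
  shows qbounded_ops_linear: "bounded_linear T" and qbounded_ops_qscale: "T (x \<cdot>\<^sub>Q a) = T x \<cdot>\<^sub>Q a"
proof -
  from assms obtain K where K: "\<And>x. norm (T x) \<le> norm x * K" by (auto simp: qbounded_ops_def)
  show "T (x \<cdot>\<^sub>Q a) = T x \<cdot>\<^sub>Q a" for x a using assms by (auto simp: qbounded_ops_def)
  from this[of _ "of_real _"] have "T (r *\<^sub>R x) = r *\<^sub>R T x" for r x
    by (simp only: qscale_of_real)
  then show "bounded_linear T"
    using assms K by (intro bounded_linear_intro[of T K]) (auto simp: qbounded_ops_def)
qed

lemma qbounded_opsI:
  assumes "bounded_linear T" "\<And>x a. T (x \<cdot>\<^sub>Q a) = T x \<cdot>\<^sub>Q a"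
  shows "T \<in> \<B>"
  unfolding qbounded_ops_def
  using assms(2) bounded_linear.bounded[OF assms(1)] linear_add[OF bounded_linear.linear[OF assms(1)]]
  by blast

lemma qadjoint_eqI:
  assumes "\<And>x y. qinner (S x) y = qinner x (T y)"
  shows "qadjoint T = S"
  unfolding qadjoint_def
proof (rule the_equality)
  show "S' = S" if "\<forall>x y. qinner (S' x) y = qinner x (T y)" for S'
  proof
    show "S' x = S x" for x
      by (rule eqI_qinner_left) (simp only: that assms)
  qed
qed (use assms in blast)

text \<open>Riesz representation yields \<open>S\<close> for the real part of the product only.
  Replacing \<open>y\<close> by \<open>y \<cdot>\<^sub>Q a\<close> and using right linearity of
  \<open>T\<close> recovers the quaternionic identity.\<close>

lemma qinner_qadjoint_left:
  assumes "T \<in> \<B>"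
  shows "qinner (qadjoint T x) y = qinner x (T y)"
proof -
  interpret bounded_linear T by (rule qbounded_ops_linear) fact
  have "\<exists>z. \<forall>y. inner x (T y) = inner z y" for x
    by (rule riesz_representation)
      (rule bounded_linear_compose[OF bounded_linear_inner_right bounded_linear_axioms])
  then obtain S where S: "\<And>x y. inner x (T y) = inner (S x) y" by metis
  have "qinner (S x) y = qinner x (T y)" for x y
    by (rule qinner_eqI) (simp add: S flip: qbounded_ops_qscale[OF assms])
  then show ?thesis by (simp add: qadjoint_eqI[of S])
qed

lemma qinner_qadjoint_right:
  assumes "T \<in> \<B>"
  shows "qinner x (qadjoint T y) = qinner (T x) y"
  by (subst (1 2) qinner_commute) (simp add: qinner_qadjoint_left assms)

lemma qadjoint_qbounded:
  assumes "T \<in> \<B>"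
  shows "qadjoint T \<in> \<B>"
proof (rule qbounded_opsI)
  note [simp] = qinner_qadjoint_left[OF assms]
  obtain K where K: "\<And>x. norm (T x) \<le> norm x * K" "K > 0"
    using bounded_linear.pos_bounded[OF qbounded_ops_linear[OF assms]] by blast
  show "bounded_linear (qadjoint T)"
  proof (rule bounded_linear_intro[where K = K])
    fix x
    let ?y = "qadjoint T x"
    have "(norm ?y)\<^sup>2 = norm (qinner ?y ?y)"
      unfolding qinner_self by (simp only: norm_of_real) simp
    also have "\<dots> = norm (qinner x (T ?y))" by simp
    also have "\<dots> \<le> norm x * (norm ?y * K)"
      by (rule order_trans[OF qinner_cauchy_schwarz]) (intro mult_left_mono K(1) norm_ge_zero)
    finally have "norm ?y * norm ?y \<le> norm x * K * norm ?y"
      by (simp add: power2_eq_square algebra_simps)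
    then show "norm ?y \<le> norm x * K"
      using K(2) by (cases "norm ?y = 0") (auto simp: mult_le_cancel_right)
  qed (rule eqI_qinner_left, simp add: qinner_add_left qinner_scaleR_left)+
  show "qadjoint T (x \<cdot>\<^sub>Q a) = qadjoint T x \<cdot>\<^sub>Q a" for x a
    by (rule eqI_qinner_left) (simp add: qinner_qscale_left)
qed

section \<open>The greedy construction of singular vectors\<close>

lemma qcompact_ops_qbounded: "T \<in> \<B>\<^sub>0 \<Longrightarrow> T \<in> \<B>"
  by (simp add: qcompact_ops_def)

lemma qcompact_ops_subsequence:
  fixes T :: "'h::quaternionic_hilbert_space \<Rightarrow> 'h" and X :: "nat \<Rightarrow> 'h"
  assumes "T \<in> \<B>\<^sub>0" "\<And>n. norm (X n) \<le> 1"
  obtains l r where "strict_mono r" "(\<lambda>n. T (X (r n))) \<longlonglongrightarrow> l"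
proof -
  have "compact (closure (T ` cball 0 1))"
    using assms(1) by (simp add: qcompact_ops_def)
  moreover have "T (X n) \<in> closure (T ` cball 0 1)" for n
    using assms(2) by (intro closure_subset[THEN subsetD]) simp
  ultimately obtain l r where "strict_mono r" "((\<lambda>n. T (X n)) \<circ> r) \<longlonglongrightarrow> l"
    unfolding compact_def by (metis (no_types, lifting))
  then show ?thesis using that[of r l] by (simp add: o_def)
qed

lemma qinner_qadjoint_comp:
  assumes "T \<in> \<B>"
  shows "qinner (qadjoint T (T x)) y = qinner (T x) (T y)"
    and "qinner x (qadjoint T (T y)) = qinner (T x) (T y)"
    and "inner (qadjoint T (T x)) y = inner (T x) (T y)"
    and "inner x (qadjoint T (T y)) = inner (T x) (T y)"
  by (simp_all add: inner_eq_qRe_qinner qinner_qadjoint_left qinner_qadjoint_right assms)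

text \<open>Let \<mu> be the supremum of the squared norm of \<open>T x\<close> over the unit ball
  of \<open>W\<close>. Along a maximising sequence, \<open>A x - \<mu> *\<^sub>R x\<close> tends to
  0. Compactness makes \<open>T x\<close> converge along a subsequence, hence \<open>A x\<close>,
  hence \<open>x\<close> itself because \<mu> > 0. The limit is an eigenvector for \<mu>.\<close>

lemma compact_maximal_eigenvector:
  fixes T :: "'h::quaternionic_hilbert_space \<Rightarrow> 'h"
  assumes T: "T \<in> \<B>\<^sub>0"
    and W: "closed W" "subspace W" "\<And>x. x \<in> W \<Longrightarrow> qadjoint T (T x) \<in> W"
    and nz: "x0 \<in> W" "T x0 \<noteq> 0"
  obtains y \<mu> where "y \<in> W" "y \<noteq> 0" "qadjoint T (T y) = \<mu> *\<^sub>R y"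
    "\<And>x. x \<in> W \<Longrightarrow> (norm (T x))\<^sup>2 \<le> \<mu> * (norm x)\<^sup>2"
proof -
  note TB = qcompact_ops_qbounded[OF T]
  interpret T: bounded_linear T by (rule qbounded_ops_linear[OF TB])
  interpret T': bounded_linear "qadjoint T"
    by (rule qbounded_ops_linear[OF qadjoint_qbounded[OF TB]])
  define A where "A x = qadjoint T (T x)" for x
  define S where "S = (\<lambda>x. (norm (T x))\<^sup>2) ` (W \<inter> cball 0 1)"
  define \<mu> where "\<mu> = Sup S"
  have S0: "0 \<in> S"
    using subspace_0[OF W(2)] by (auto simp: S_def T.zero intro!: image_eqI[of _ _ 0])
  obtain K where K: "\<And>x. norm (T x) \<le> norm x * K" "K > 0"
    using T.pos_bounded by blast
  have bdd: "bdd_above S"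
  proof (rule bdd_aboveI)
    fix s assume "s \<in> S"
    then obtain x where x: "norm x \<le> 1" "s = (norm (T x))\<^sup>2" by (auto simp: S_def)
    have "norm (T x) \<le> K"
      using K(1)[of x] mult_right_mono[OF x(1), of K] K(2) by linarith
    then show "s \<le> K\<^sup>2" by (simp add: x power_mono)
  qed
  have bound: "(norm (T x))\<^sup>2 \<le> \<mu> * (norm x)\<^sup>2" if "x \<in> W" for x
  proof (cases "x = 0")
    case False
    have "(norm (T (x /\<^sub>R norm x)))\<^sup>2 \<in> S"
      unfolding S_def using that False W(2) by (intro imageI) (simp add: subspace_scale)
    then have "(norm (T (x /\<^sub>R norm x)))\<^sup>2 \<le> \<mu>"
      unfolding \<mu>_def by (rule cSup_upper[OF _ bdd])
    then show ?thesis
      using False by (simp add: T.scaleR power_mult_distrib field_simps)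
  qed (simp add: T.zero)
  have \<mu>: "\<mu> > 0"
  proof -
    have "0 < (norm (T x0))\<^sup>2" using nz by simp
    also have "\<dots> \<le> \<mu> * (norm x0)\<^sup>2" by (rule bound[OF nz(1)])
    finally show ?thesis by (simp add: zero_less_mult_iff)
  qed
  \<comment> \<open>(norm (A x))^2 is the real product of \<open>T x\<close> and
    \<open>T (A x)\<close>. Since \<open>W\<close> is invariant, \<mu> controls both factors;
    squaring Cauchy-Schwarz and cancelling (norm (A x))^2 avoids square roots of \<mu>.\<close>
  have normA: "(norm (A x))\<^sup>2 \<le> \<mu>\<^sup>2 * (norm x)\<^sup>2" if "x \<in> W" for x
  proof (cases "A x = 0")
    case False
    have "A x \<in> W" using W(3)[OF that] by (simp add: A_def)
    have "(norm (A x))\<^sup>2 = inner (T x) (T (A x))"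
      by (simp add: A_def power2_norm_eq_inner qinner_qadjoint_comp(3)[OF TB])
    also have "\<dots> \<le> norm (T x) * norm (T (A x))" by (rule norm_cauchy_schwarz)
    finally have "((norm (A x))\<^sup>2)\<^sup>2 \<le> (norm (T x) * norm (T (A x)))\<^sup>2"
      by (rule power_mono) simp
    also have "\<dots> \<le> (\<mu> * (norm x)\<^sup>2) * (\<mu> * (norm (A x))\<^sup>2)"
      unfolding power_mult_distrib using \<mu>
      by (intro mult_mono bound that \<open>A x \<in> W\<close>) auto
    finally have "(norm (A x))\<^sup>2 * (norm (A x))\<^sup>2 \<le> (\<mu>\<^sup>2 * (norm x)\<^sup>2) * (norm (A x))\<^sup>2"
      by (simp add: power2_eq_square algebra_simps)
    then show ?thesis by (rule mult_right_le_imp_le) (use False in simp)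
  qed simp
  have "\<exists>x. x \<in> W \<and> norm x \<le> 1 \<and> \<mu> - inverse (real (Suc n)) < (norm (T x))\<^sup>2" for n
  proof -
    obtain s where "s \<in> S" "\<mu> - inverse (real (Suc n)) < s"
      using less_cSupD[of S "\<mu> - inverse (real (Suc n))"] S0
      by (auto simp: \<mu>_def[symmetric] simp del: of_nat_Suc)
    then show ?thesis by (auto simp: S_def simp del: of_nat_Suc)
  qed
  then obtain X where X: "\<And>n. X n \<in> W" "\<And>n. norm (X n) \<le> 1"
    "\<And>n. \<mu> - inverse (real (Suc n)) < (norm (T (X n)))\<^sup>2" by metis
  obtain l r where r: "strict_mono r" and l: "(\<lambda>n. T (X (r n))) \<longlonglongrightarrow> l"
    using qcompact_ops_subsequence[OF T, of X] X(2) by blast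
  have norm_expand: "(norm (a - \<mu> *\<^sub>R b))\<^sup>2 = (norm a)\<^sup>2 - 2 * \<mu> * inner a b + \<mu>\<^sup>2 * (norm b)\<^sup>2"
    for a b :: 'h
    unfolding power2_norm_eq_inner
    by (simp add: inner_diff_left inner_diff_right inner_commute power2_eq_square algebra_simps)
  \<comment> \<open>The outer terms of the expansion are at most \<mu>^2 each, and the mixed term is
    at least 2 \<mu> (\<mu> - 1/(n+1)) in size, so only 2 \<mu> / (n+1) survives.\<close>
  have sq_bound: "(norm (A (X n) - \<mu> *\<^sub>R X n))\<^sup>2 \<le> 2 * \<mu> * inverse (real (Suc n))" for n
  proof -
    have "(norm (A (X n) - \<mu> *\<^sub>R X n))\<^sup>2
        = (norm (A (X n)))\<^sup>2 - 2 * \<mu> * (norm (T (X n)))\<^sup>2 + \<mu>\<^sup>2 * (norm (X n))\<^sup>2"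
      unfolding norm_expand by (simp add: A_def qinner_qadjoint_comp(3)[OF TB] power2_norm_eq_inner)
    moreover have "\<mu>\<^sup>2 * (norm (X n))\<^sup>2 \<le> \<mu>\<^sup>2 * 1"
      using X(2)[of n] by (intro mult_left_mono power_le_one) auto
    moreover have "2 * \<mu> * (\<mu> - inverse (real (Suc n))) \<le> 2 * \<mu> * (norm (T (X n)))\<^sup>2"
      using X(3)[of n] \<mu> by (intro mult_left_mono) auto
    moreover have "2 * \<mu> * (\<mu> - inverse (real (Suc n))) = 2 * \<mu>\<^sup>2 - 2 * \<mu> * inverse (real (Suc n))"
      by (simp add: algebra_simps power2_eq_square)
    ultimately show ?thesis using normA[OF X(1)[of n]] by linarith
  qed
  have inv0: "(\<lambda>n. inverse (real (Suc n))) \<longlonglongrightarrow> 0" by (rule LIMSEQ_inverse_real_of_nat)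
  have "(\<lambda>n. 2 * \<mu> * inverse (real (Suc n))) \<longlonglongrightarrow> 0"
    using tendsto_mult[OF tendsto_const inv0, of "2 * \<mu>"] by simp
  then have "(\<lambda>n. (norm (A (X n) - \<mu> *\<^sub>R X n))\<^sup>2) \<longlonglongrightarrow> 0"
    by (rule Lim_null_comparison[OF always_eventually, rotated]) (use sq_bound in simp)
  then have "(\<lambda>n. sqrt ((norm (A (X n) - \<mu> *\<^sub>R X n))\<^sup>2)) \<longlonglongrightarrow> sqrt 0"
    by (rule tendsto_real_sqrt)
  then have "(\<lambda>n. A (X n) - \<mu> *\<^sub>R X n) \<longlonglongrightarrow> 0"
    by (simp add: tendsto_norm_zero_iff)
  from LIMSEQ_subseq_LIMSEQ[OF this r]
  have d0: "(\<lambda>n. A (X (r n)) - \<mu> *\<^sub>R X (r n)) \<longlonglongrightarrow> 0" by (simp add: o_def)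
  have Al: "(\<lambda>n. A (X (r n))) \<longlonglongrightarrow> qadjoint T l"
    unfolding A_def by (rule T'.tendsto[OF l])
  \<comment> \<open>Solving the approximate eigenvalue equation for \<open>X (r n)\<close> transfers
    convergence from \<open>A (X (r n))\<close> to the vectors themselves.\<close>
  have "(\<lambda>n. (A (X (r n)) - (A (X (r n)) - \<mu> *\<^sub>R X (r n))) /\<^sub>R \<mu>) \<longlonglongrightarrow> (qadjoint T l - 0) /\<^sub>R \<mu>"
    by (intro tendsto_intros Al d0)
  then have z: "(\<lambda>n. X (r n)) \<longlonglongrightarrow> qadjoint T l /\<^sub>R \<mu>" (is "_ \<longlonglongrightarrow> ?z")
    using \<mu> by simp
  have zW: "?z \<in> W"
    using closed_sequentially[OF W(1) _ z] X(1) by simp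
  have "T ?z = l" using LIMSEQ_unique[OF T.tendsto[OF z] l] .
  then have "qadjoint T (T ?z) = \<mu> *\<^sub>R ?z" using \<mu> by simp
  \<comment> \<open>The values of \<open>T\<close> along the sequence have squared norm tending to
    at least \<mu> > 0, so their limit \<open>l\<close>, which is \<open>T ?z\<close>, cannot
    vanish.\<close>
  moreover have "?z \<noteq> 0"
  proof
    assume "?z = 0"
    with \<open>T ?z = l\<close> have "l = 0" by (simp only: T.zero)
    have "(\<lambda>n. \<mu> - inverse (real (Suc (r n)))) \<longlonglongrightarrow> \<mu> - 0"
      using LIMSEQ_subseq_LIMSEQ[OF inv0 r] by (intro tendsto_diff tendsto_const) (simp add: o_def)
    moreover have "(\<lambda>n. (norm (T (X (r n))))\<^sup>2) \<longlonglongrightarrow> (norm l)\<^sup>2" by (intro tendsto_intros l)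
    ultimately have "\<mu> - 0 \<le> (norm l)\<^sup>2"
      by (rule LIMSEQ_le) (use X(3) in \<open>auto intro: less_imp_le\<close>)
    with \<mu> \<open>l = 0\<close> show False by simp
  qed
  ultimately show ?thesis using that[OF zW] bound by blast
qed

section \<open>Eigenspaces invariant under \<open>J\<close> and the slice
  \<open>H_plus J i\<close>\<close>

lemma anti_selfadjointD:
  assumes "J \<in> \<B>" "anti_selfadjoint J"
  shows "qinner (J x) y = - qinner x (J y)"
proof -
  have "- qinner (J x) y = qinner (qadjoint J x) y"
    using assms(2) by (simp add: anti_selfadjoint_def qinner_minus_left)
  also have "\<dots> = qinner x (J y)" by (rule qinner_qadjoint_left[OF assms(1)])
  finally show ?thesis by (simp add: equation_minus_iff)
qed

lemma anti_selfadjoint_unitary_square: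
  assumes "anti_selfadjoint J" "qunitary J"
  shows "J (J x) = - x"
proof -
  have "- J (J x) = (qadjoint J \<circ> J) x"
    using assms(1) by (simp add: anti_selfadjoint_def)
  also have "\<dots> = x" using assms(2) by (simp add: qunitary_def)
  finally show ?thesis by (simp add: minus_equation_iff)
qed

lemma qadjoint_commute:
  assumes "T \<in> \<B>" "J \<in> \<B>" "anti_selfadjoint J" "\<And>x. T (J x) = J (T x)"
  shows "qadjoint T (J x) = J (qadjoint T x)"
proof (rule eqI_qinner_left)
  fix y
  note a = anti_selfadjointD[OF assms(2,3)] and b = qinner_qadjoint_left[OF assms(1)]
  show "qinner (qadjoint T (J x)) y = qinner (J (qadjoint T x)) y"
    by (simp only: a b assms(4))
qed

text \<open>Applied to an eigenspace of T*T within an orthogonal complement, this replaces an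
  arbitrary eigenvector by a unit one in the slice, with the same eigenvalue.\<close>

lemma H_plus_unit_vector:
  fixes E :: "'h::quaternionic_hilbert_space set"
  assumes J: "J \<in> \<B>" "\<And>x. J (J x) = - x" and i: "i \<in> \<S>"
    and E: "\<And>x y. x \<in> E \<Longrightarrow> y \<in> E \<Longrightarrow> x + y \<in> E" "\<And>x a. x \<in> E \<Longrightarrow> x \<cdot>\<^sub>Q a \<in> E"
      "\<And>x. x \<in> E \<Longrightarrow> J x \<in> E"
    and y: "y \<in> E" "y \<noteq> 0"
  shows "\<exists>v\<in>E \<inter> H_plus J i. norm v = 1"
proof -
  interpret J: bounded_linear J by (rule qbounded_ops_linear[OF J(1)])
  note Js = qbounded_ops_qscale[OF J(1)]
  note ii = imaginary_unit_square[OF i]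
  obtain j where j: "j \<noteq> 0" "i * j = - (j * i)" by (rule imaginary_anticommuting[OF i])
  \<comment> \<open>Up to the factor 2, \<open>v\<close> is the component of \<open>y\<close> on
    which \<open>J\<close> acts as right multiplication by \<open>i\<close>. The other component, on
    which \<open>J\<close> acts as \<open>- i\<close>, is carried into the slice by
    \<open>j\<close>; this gives \<open>w\<close>. If both vanish, adding them gives
    \<open>y + y = 0\<close>.\<close>
  define v where "v = y + J y \<cdot>\<^sub>Q (- i)"
  define w where "w = (y + J y \<cdot>\<^sub>Q i) \<cdot>\<^sub>Q j"
  have vE: "v \<in> E" "w \<in> E" by (auto simp: v_def w_def intro!: E y)
  have neg: "- x = x \<cdot>\<^sub>Q (- 1)" for x :: 'h
    by (simp add: qscale_minus_right qscale_one)
  have v: "J v = v \<cdot>\<^sub>Q i"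
    by (simp add: v_def J.add Js J(2) qscale_add_left qscale_qscale ii qscale_one neg)
  have "i * (j * i) = i * j * i" by (simp add: mult.assoc)
  also have "\<dots> = - (j * (i * i))" by (simp only: j(2) mult_minus_left mult.assoc)
  finally have ij: "i * (j * i) = j" by (simp add: ii)
  have w: "J w = w \<cdot>\<^sub>Q i"
    by (simp only: w_def J.add Js J(2) qscale_add_left qscale_qscale mult.assoc ij)
      (simp add: neg qscale_qscale j(2) add.commute flip: mult_minus_right)
  have "v \<noteq> 0 \<or> w \<noteq> 0"
  proof (rule ccontr)
    assume *: "\<not> (v \<noteq> 0 \<or> w \<noteq> 0)"
    then have "norm (y + J y \<cdot>\<^sub>Q i) * norm j = 0" by (simp add: w_def flip: norm_qscale)
    then have "y + J y \<cdot>\<^sub>Q i = 0" using j(1) by simp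
    moreover have "v = 0" using * by simp
    ultimately have "y + y = 0"
      by (simp add: v_def qscale_minus_right)
    then have "2 *\<^sub>R y = 0" by (simp add: scaleR_2)
    then show False using y(2) by simp
  qed
  then obtain u where u: "u \<in> E" "J u = u \<cdot>\<^sub>Q i" "u \<noteq> 0" using v w vE by blast
  have "u /\<^sub>R norm u \<in> E"
    using E(2)[OF u(1), of "of_real (inverse (norm u))"] by (simp only: qscale_of_real)
  moreover have "J (u /\<^sub>R norm u) = (u /\<^sub>R norm u) \<cdot>\<^sub>Q i"
    by (simp only: J.scaleR u linear_scale[OF bounded_linear.linear[OF bounded_linear_qscale_left]])
  ultimately show ?thesis
    using u(3) by (intro bexI[of _ "u /\<^sub>R norm u"]) (auto simp: H_plus_def)
qed

text \<open>The sequence continues with \<open>e n = 0\<close> once \<open>T\<close> vanishes on the orthogonal complement of the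
  vectors chosen so far, so that finite and infinite rank need no separate treatment.\<close>

locale singular_system =
  fixes T :: "'h::quaternionic_hilbert_space \<Rightarrow> 'h" and e :: "nat \<Rightarrow> 'h"
  assumes compact: "T \<in> \<B>\<^sub>0"
    and orth: "m \<noteq> n \<Longrightarrow> qinner (e m) (e n) = 0"
    and norm_0_or_1: "e n = 0 \<or> norm (e n) = 1"
    and eigenvector: "qadjoint T (T (e n)) = (norm (T (e n)))\<^sup>2 *\<^sub>R e n"
    and maximal: "(\<And>m. m < n \<Longrightarrow> qinner (e m) x = 0) \<Longrightarrow> norm (T x) \<le> norm (T (e n)) * norm x"

lemma singular_system_exists:
  fixes J T :: "'h::quaternionic_hilbert_space \<Rightarrow> 'h"
  assumes J: "J \<in> \<B>" "anti_selfadjoint J" "qunitary J" and i: "i \<in> \<S>"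
    and T: "T \<in> \<B>\<^sub>0" and TJ: "\<And>x. T (J x) = J (T x)"
  shows "\<exists>e. singular_system T e \<and> range e \<subseteq> H_plus J i"
proof -
  note TB = qcompact_ops_qbounded[OF T]
  interpret T: bounded_linear T by (rule qbounded_ops_linear[OF TB])
  interpret J: bounded_linear J by (rule qbounded_ops_linear[OF J(1)])
  interpret T': bounded_linear "qadjoint T"
    by (rule qbounded_ops_linear[OF qadjoint_qbounded[OF TB]])
  \<comment> \<open>\<open>P f n r\<close> means that \<open>r\<close> is an admissible choice at
    stage \<open>n\<close> after \<open>f\<close>. It consults \<open>f\<close> only below
    \<open>n\<close>, as well-founded choice requires, and it records membership in the slice
    because the next stage needs it for the \<open>J\<close>-invariance of the complement.\<close>
  define P where "P f n r \<longleftrightarrow> r \<in> H_plus J i \<and> (r = 0 \<or> norm r = 1) \<and>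
      (\<forall>m<n. qinner (f m) r = 0) \<and> qadjoint T (T r) = (norm (T r))\<^sup>2 *\<^sub>R r \<and>
      (\<forall>x. (\<forall>m<n. qinner (f m) x = 0) \<longrightarrow> norm (T x) \<le> norm (T r) * norm x)"
    for f :: "nat \<Rightarrow> 'h" and n r
  have "\<exists>e. \<forall>n. P e n (e n)"
  proof (rule dependent_wf_choice[OF wf_less_than])
    fix f g :: "nat \<Rightarrow> 'h" and n r
    assume "\<And>z. (z, n) \<in> less_than \<Longrightarrow> f z = g z"
    then show "P f n r = P g n r" by (simp add: P_def)
  next
    fix n and f :: "nat \<Rightarrow> 'h"
    assume "\<And>m. (m, n) \<in> less_than \<Longrightarrow> P f m (f m)"
    then have Pm: "\<And>m. m < n \<Longrightarrow> P f m (f m)" by simp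
    define W where "W = {x. \<forall>m<n. qinner (f m) x = 0}"
    show "\<exists>r. P f n r"
    proof (cases "\<forall>x\<in>W. T x = 0")
      case True
      \<comment> \<open>Here \<open>T\<close> kills the whole complement, so the maximality clause
        for the choice 0 reads 0 \<le> 0.\<close>
      then have "P f n 0"
        by (simp add: P_def H_plus_def T.zero T'.zero J.zero W_def)
      then show ?thesis ..
    next
      case False
      then obtain x0 where x0: "x0 \<in> W" "T x0 \<noteq> 0" by blast
      have W_eq: "W = (\<Inter>m\<in>{..<n}. {x. qinner (f m) x = 0})" by (auto simp: W_def)
      have "closed W"
        unfolding W_eq
        by (intro closed_INT ballI closed_Collect_eq continuous_on_const
            linear_continuous_on bounded_linear_qinner_right)
      moreover have "subspace W"
        by (auto simp: subspace_def W_def qinner_add_right qinner_scaleR_right)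
      moreover have WA: "qadjoint T (T x) \<in> W" if "x \<in> W" for x
      proof -
        have "qinner (f m) (qadjoint T (T x)) = (norm (T (f m)))\<^sup>2 *\<^sub>R qinner (f m) x" if "m < n" for m
        proof -
          have "qinner (f m) (qadjoint T (T x)) = qinner (qadjoint T (T (f m))) x"
            by (simp add: qinner_qadjoint_comp[OF TB])
          also have "qadjoint T (T (f m)) = (norm (T (f m)))\<^sup>2 *\<^sub>R f m"
            using Pm[OF that] by (simp add: P_def)
          finally show ?thesis by (simp add: qinner_scaleR_left)
        qed
        with that show ?thesis by (simp add: W_def)
      qed
      ultimately obtain y \<mu> where y: "y \<in> W" "y \<noteq> 0" "qadjoint T (T y) = \<mu> *\<^sub>R y"
        and bound: "\<And>x. x \<in> W \<Longrightarrow> (norm (T x))\<^sup>2 \<le> \<mu> * (norm x)\<^sup>2"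
        using compact_maximal_eigenvector[OF T _ _ _ x0] by blast
      define E where "E = {x \<in> W. qadjoint T (T x) = \<mu> *\<^sub>R x}"
      have "\<exists>v\<in>E \<inter> H_plus J i. norm v = 1"
      proof (rule H_plus_unit_vector[OF J(1) anti_selfadjoint_unitary_square[OF J(2,3)] i])
        show "a + b \<in> E" if "a \<in> E" "b \<in> E" for a b
          using that by (simp add: E_def W_def qinner_add_right T.add T'.add scaleR_right_distrib)
        show "a \<cdot>\<^sub>Q c \<in> E" if "a \<in> E" for a c
          using that
          by (simp add: E_def W_def qinner_qscale_right qbounded_ops_qscale[OF TB]
              qbounded_ops_qscale[OF qadjoint_qbounded[OF TB]]
              linear_scale[OF bounded_linear.linear[OF bounded_linear_qscale_left]])
        show "J a \<in> E" if "a \<in> E" for a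
        proof -
          \<comment> \<open>As \<open>f m\<close> lies in the slice, \<open>J\<close> only
            multiplies it by \<open>i\<close> on the right. Moving \<open>J\<close> across the
            product therefore preserves orthogonality to \<open>f m\<close>.\<close>
          have "qinner (f m) (J a) = 0" if "m < n" for m
          proof -
            have "f m \<in> H_plus J i" using Pm[OF that] by (simp add: P_def)
            then have "qinner (f m) (J a) = - qinner (f m \<cdot>\<^sub>Q i) a"
              using anti_selfadjointD[OF J(1,2), of "f m" a] by (simp add: H_plus_def)
            then show ?thesis
              using \<open>a \<in> E\<close> \<open>m < n\<close> by (simp add: qinner_qscale_left E_def W_def)
          qed
          then show ?thesis
            using that
            by (simp add: E_def W_def TJ qadjoint_commute[OF TB J(1,2) TJ] J.scaleR)
        qed
      qed (use y in \<open>auto simp: E_def\<close>)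
      then obtain r where r: "r \<in> E" "r \<in> H_plus J i" "norm r = 1" by blast
      have "(norm (T r))\<^sup>2 = inner (qadjoint T (T r)) r"
        by (simp add: qinner_qadjoint_comp[OF TB] power2_norm_eq_inner)
      also have "\<dots> = \<mu>" using r by (simp add: E_def flip: power2_norm_eq_inner)
      finally have \<mu>: "(norm (T r))\<^sup>2 = \<mu>" .
      have "norm (T x) \<le> norm (T r) * norm x" if "x \<in> W" for x
        by (rule power2_le_imp_le) (use bound[OF that] in \<open>simp_all add: power_mult_distrib \<mu>\<close>)
      then have "P f n r"
        using r unfolding P_def \<mu> by (simp add: E_def W_def)
      then show ?thesis ..
    qed
  qed
  then obtain e where e: "\<And>n. P e n (e n)" by blast
  have lt: "qinner (e m) (e n) = 0" if "m < n" for m n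
    using e[of n] that by (simp add: P_def)
  have "singular_system T e"
  proof
    show "qinner (e m) (e n) = 0" if "m \<noteq> n" for m n
      using that lt[of m n] lt[of n m] qinner_zero_commute[of "e m"] by (metis linorder_neqE_nat)
  qed (use e T in \<open>auto simp: P_def\<close>)
  moreover have "range e \<subseteq> H_plus J i" using e by (auto simp: P_def)
  ultimately show ?thesis by blast
qed

section \<open>Invariance of the quaternionic dimension\<close>

definition quat_basis :: "quat set" where
  "quat_basis = {1, Quat 0 1 0 0, Quat 0 0 1 0, Quat 0 0 0 1}"

lemma quat_basis_facts:
  "finite quat_basis" "card quat_basis = 4" "0 \<notin> quat_basis"
  by (auto simp: quat_basis_def quat_eq_iff)

lemma quat_basis_expansion:
  "a = qRe a *\<^sub>R 1 + qI a *\<^sub>R Quat 0 1 0 0 + qJ a *\<^sub>R Quat 0 0 1 0 + qK a *\<^sub>R Quat 0 0 0 1"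
  by (simp add: quat_eq_iff)

lemma quat_basis_independent:
  assumes "(\<Sum>q\<in>quat_basis. r q *\<^sub>R q) = 0" "q \<in> quat_basis"
  shows "r q = 0"
proof -
  have "r 1 = 0 \<and> r (Quat 0 1 0 0) = 0 \<and> r (Quat 0 0 1 0) = 0 \<and> r (Quat 0 0 0 1) = 0"
    using assms(1) by (simp add: quat_basis_def quat_eq_iff)
  then show ?thesis using assms(2) unfolding quat_basis_def by blast
qed

text \<open>A coincidence would be a nontrivial right linear relation in \<open>B\<close>, since
  \<open>quat_basis\<close> does not contain 0. Injectivity makes the real family exactly four times
  as large as a finite \<open>B\<close>.\<close>

lemma qindependent_smult_inj:
  assumes "qindependent B"
  shows "inj_on (\<lambda>(b, q). b \<cdot>\<^sub>Q q) (B \<times> quat_basis)"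
proof (rule inj_onI, clarify)
  fix b q b' q'
  assume *: "b \<in> B" "q \<in> quat_basis" "b' \<in> B" "q' \<in> quat_basis" "b \<cdot>\<^sub>Q q = b' \<cdot>\<^sub>Q q'"
  have ind: "\<And>F c. finite F \<Longrightarrow> F \<subseteq> B \<Longrightarrow> (\<Sum>b\<in>F. b \<cdot>\<^sub>Q c b) = 0 \<Longrightarrow> \<forall>b\<in>F. c b = 0"
    using assms by (simp add: qindependent_def)
  show "b = b' \<and> q = q'"
  proof (cases "b = b'")
    case True
    have "b \<cdot>\<^sub>Q (q - q') = 0"
      using * True by (simp add: linear_diff[OF bounded_linear.linear[OF bounded_linear_qscale_right]])
    then have "q - q' = 0" using ind[of "{b}" "\<lambda>_. q - q'"] *(1) by simp
    with True show ?thesis by simp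
  next
    case False
    then have "(\<Sum>x\<in>{b, b'}. x \<cdot>\<^sub>Q (if x = b then q else - q')) = 0"
      using *(5) by (simp add: qscale_minus_right)
    then have "q = 0" using ind[of "{b, b'}" "\<lambda>x. if x = b then q else - q'"] * by simp
    then show ?thesis using *(2) quat_basis_facts(3) by simp
  qed
qed

text \<open>A quaternionic basis, multiplied by \<open>1, i, j, k\<close>, is a real basis, so that the exchange
  lemma for real vector spaces applies.\<close>

lemma qindependent_imp_real_independent:
  fixes B :: "'h::quaternionic_hilbert_space set"
  assumes "qindependent B"
  shows "independent ((\<lambda>(b, q). b \<cdot>\<^sub>Q q) ` (B \<times> quat_basis))"
proof -
  define g :: "'h \<times> quat \<Rightarrow> 'h" where "g = (\<lambda>(b, q). b \<cdot>\<^sub>Q q)"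
  have inj: "inj_on g (B \<times> quat_basis)"
    unfolding g_def by (rule qindependent_smult_inj[OF assms])
  have "independent (g ` (B \<times> quat_basis))"
    unfolding dependent_explicit
  proof safe
    fix t r v
    assume t: "finite t" "t \<subseteq> g ` (B \<times> quat_basis)" "(\<Sum>v\<in>t. r v *\<^sub>R v) = 0" "v \<in> t" "r v \<noteq> 0"
    \<comment> \<open>\<open>t\<close> may contain only some of the four multiples of a vector;
      extending the coefficients by 0 completes them, so that the sum can be grouped by
      \<open>b\<close>.\<close>
    define r' where "r' v = (if v \<in> t then r v else 0)" for v
    obtain G where G: "finite G" "G \<subseteq> B \<times> quat_basis" "t = g ` G"
      using finite_subset_image[OF t(1,2)] by blast
    define F where "F = fst ` G"
    have F: "finite F" "F \<subseteq> B" and sub: "t \<subseteq> g ` (F \<times> quat_basis)"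
      using G by (auto simp: F_def image_iff) (force+)
    have FB: "F \<times> quat_basis \<subseteq> B \<times> quat_basis" using F by auto
    have "0 = (\<Sum>v\<in>g ` (F \<times> quat_basis). r' v *\<^sub>R v)"
      unfolding t(3)[symmetric] using sub F(1) quat_basis_facts(1)
      by (intro sum.mono_neutral_cong_left) (auto simp: r'_def)
    also have "\<dots> = (\<Sum>(b, q)\<in>F \<times> quat_basis. r' (g (b, q)) *\<^sub>R g (b, q))"
      using inj_on_subset[OF inj FB] by (subst sum.reindex) (auto simp: case_prod_beta)
    \<comment> \<open>The four real coefficients belonging to \<open>b\<close> are collected into a
      single quaternion.\<close>
    also have "\<dots> = (\<Sum>b\<in>F. b \<cdot>\<^sub>Q (\<Sum>q\<in>quat_basis. r' (g (b, q)) *\<^sub>R q))"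
      by (simp add: g_def linear_sum[OF bounded_linear.linear[OF bounded_linear_qscale_right]]
          linear_scale[OF bounded_linear.linear[OF bounded_linear_qscale_right]]
          flip: sum.cartesian_product)
    finally have "\<forall>b\<in>F. (\<Sum>q\<in>quat_basis. r' (g (b, q)) *\<^sub>R q) = 0"
      using assms F
      by (auto simp: qindependent_def
          dest!: spec[of _ F] spec[of _ "\<lambda>b. \<Sum>q\<in>quat_basis. r' (g (b, q)) *\<^sub>R q"])
    then have "r' (g (b, q)) = 0" if "b \<in> F" "q \<in> quat_basis" for b q
      using quat_basis_independent[of "\<lambda>q. r' (g (b, q))"] that by blast
    moreover obtain b q where "b \<in> F" "q \<in> quat_basis" "v = g (b, q)"
      using sub t(4) by blast
    ultimately have "r' v = 0" by simp
    with t(4,5) show False by (simp add: r'_def)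
  qed
  then show ?thesis unfolding g_def .
qed

text \<open>The real exchange lemma compares the families enlarged by the factor 4. For
  \<open>B\<close> an upper bound on the size of the image is enough, so \<open>B\<close> may be any
  finite generating set.\<close>

lemma qindependent_card_le:
  fixes B C :: "'h::quaternionic_hilbert_space set"
  assumes B: "finite B" and C: "qindependent C" "C \<subseteq> qspan B"
  shows "finite C \<and> card C \<le> card B"
proof -
  let ?g = "\<lambda>(b :: 'h, q). b \<cdot>\<^sub>Q q"
  have mem: "b \<cdot>\<^sub>Q a \<in> span (?g ` (B \<times> quat_basis))" if "b \<in> B" for a b
  proof -
    have *: "b \<cdot>\<^sub>Q q \<in> span (?g ` (B \<times> quat_basis))" if "q \<in> quat_basis" for q
      using \<open>b \<in> B\<close> that by (intro span_base) auto
    note lin = bounded_linear.linear[OF bounded_linear_qscale_right]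
    show ?thesis
      by (subst quat_basis_expansion[of a])
        (unfold linear_add[OF lin] linear_scale[OF lin],
          intro span_add span_scale *, simp_all add: quat_basis_def)
  qed
  have "?g ` (C \<times> quat_basis) \<subseteq> span (?g ` (B \<times> quat_basis))"
  proof clarify
    fix c q assume "c \<in> C"
    then obtain F a where F: "finite F" "F \<subseteq> B" "c = (\<Sum>b\<in>F. b \<cdot>\<^sub>Q a b)"
      using C(2) by (auto simp: qspan_def)
    have "c \<cdot>\<^sub>Q q = (\<Sum>b\<in>F. b \<cdot>\<^sub>Q (a b * q))"
      by (simp add: F(3) linear_sum[OF bounded_linear.linear[OF bounded_linear_qscale_left]]
          qscale_qscale)
    then show "c \<cdot>\<^sub>Q q \<in> span (?g ` (B \<times> quat_basis))"
      using F(2) mem by (auto intro!: span_sum)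
  qed
  then have *: "finite (?g ` (C \<times> quat_basis)) \<and>
      card (?g ` (C \<times> quat_basis)) \<le> card (?g ` (B \<times> quat_basis))"
    using B quat_basis_facts(1)
    by (intro independent_span_bound qindependent_imp_real_independent C) auto
  have inj: "inj_on ?g (C \<times> quat_basis)" by (rule qindependent_smult_inj[OF C(1)])
  have "finite (C \<times> quat_basis)" using * finite_imageD[OF _ inj] by blast
  then have "finite C"
    using quat_basis_facts by (metis card.empty finite_cartesian_productD1 zero_neq_numeral)
  moreover have "card C * 4 \<le> card B * 4"
  proof -
    have "card C * 4 = card (?g ` (C \<times> quat_basis))"
      by (simp add: card_image[OF inj] card_cartesian_product quat_basis_facts)
    also have "\<dots> \<le> card (?g ` (B \<times> quat_basis))" using * by blast
    also have "\<dots> \<le> card (B \<times> quat_basis)"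
      using B quat_basis_facts(1) by (intro card_image_le) auto
    finally show ?thesis by (simp add: card_cartesian_product quat_basis_facts)
  qed
  ultimately show ?thesis by simp
qed

text \<open>\<open>qdim\<close> counts an unspecified basis \<open>C\<close>. The cardinality bound
  applied in one direction shows that \<open>C\<close> is finite, which permits applying it in the
  other.\<close>

lemma qdim_eqI:
  assumes "finite B" "B \<subseteq> V" "qindependent B" "V \<subseteq> qspan B"
  shows "qdim V = card B"
proof -
  define C where "C = (SOME B. B \<subseteq> V \<and> qindependent B \<and> V \<subseteq> qspan B)"
  have C: "C \<subseteq> V \<and> qindependent C \<and> V \<subseteq> qspan C"
    unfolding C_def by (rule someI[of _ B]) (use assms in blast)
  then have "finite C \<and> card C \<le> card B"
    using assms by (intro qindependent_card_le) auto
  moreover from this have "card B \<le> card C"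
    using assms C qindependent_card_le[of C B] by blast
  ultimately show ?thesis unfolding qdim_def C_def[symmetric] by simp
qed

section \<open>Absolute value and singular values\<close>

text \<open>By Pythagoras the squared norm of a block of the series is the corresponding block of a
  convergent real series, so the partial sums are Cauchy.\<close>

lemma orthogonal_series_summable:
  fixes v :: "nat \<Rightarrow> 'a::{real_inner, banach}"
  assumes orth: "\<And>m n. m \<noteq> n \<Longrightarrow> inner (v m) (v n) = 0"
    and sq: "summable (\<lambda>n. (norm (v n))\<^sup>2)"
  shows "summable v" and "(norm (suminf v))\<^sup>2 \<le> (\<Sum>n. (norm (v n))\<^sup>2)"
proof -
  have pyth: "(norm (sum v F))\<^sup>2 = (\<Sum>n\<in>F. (norm (v n))\<^sup>2)" if "finite F" for F
    using that by (intro norm_sum_Pythagorean) (auto simp: pairwise_def orthogonal_def orth)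
  show sm: "summable v"
    unfolding summable_Cauchy
  proof (intro allI impI)
    fix \<epsilon> :: real assume "0 < \<epsilon>"
    then obtain N where N: "\<And>m n. m \<ge> N \<Longrightarrow> norm (\<Sum>k\<in>{m..<n}. (norm (v k))\<^sup>2) < \<epsilon>\<^sup>2"
      using sq unfolding summable_Cauchy by (meson zero_less_power)
    have "norm (sum v {m..<n}) < \<epsilon>" if "m \<ge> N" for m n
    proof (rule power2_less_imp_less)
      show "(norm (sum v {m..<n}))\<^sup>2 < \<epsilon>\<^sup>2"
        using N[OF that, of n] by (simp add: pyth sum_nonneg)
    qed (use \<open>0 < \<epsilon>\<close> in simp)
    then show "\<exists>N. \<forall>m\<ge>N. \<forall>n. norm (sum v {m..<n}) < \<epsilon>" by blast
  qed
  have "(\<lambda>k. (norm (sum v {..<k}))\<^sup>2) \<longlonglongrightarrow> (norm (suminf v))\<^sup>2"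
    by (intro tendsto_intros summable_LIMSEQ sm)
  then show "(norm (suminf v))\<^sup>2 \<le> (\<Sum>n. (norm (v n))\<^sup>2)"
    by (rule LIMSEQ_le_const2) (use sq in \<open>auto simp: pyth intro!: exI sum_le_suminf\<close>)
qed

text \<open>Polarisation: realness of the form at \<open>x + y \<cdot>\<^sub>Q a\<close> says that
  \<open>d * a\<close> equals its own conjugate, where \<open>d\<close> is the defect of symmetry.
  As \<open>a\<close> is arbitrary, \<open>d\<close> vanishes.\<close>

lemma qpositive_imp_selfadjoint:
  assumes "S \<in> \<B>" "qpositive S"
  shows "qinner (S x) y = qinner x (S y)"
proof -
  interpret S: bounded_linear S by (rule qbounded_ops_linear) fact
  have real: "qinner (S x) x = qinner x (S x)" for x
  proof -
    obtain r where "qinner x (S x) = of_real r" using assms(2) by (auto simp: qpositive_def)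
    then show ?thesis by (subst qinner_commute) simp
  qed
  define d where "d = qinner (S x) y - qinner x (S y)"
  have "d * a = qcnj (d * a)" for a
  proof -
    have "qinner (S (x + y \<cdot>\<^sub>Q a)) (x + y \<cdot>\<^sub>Q a) = qinner (x + y \<cdot>\<^sub>Q a) (S (x + y \<cdot>\<^sub>Q a))"
      by (rule real)
    then have "qinner (S x) y * a + qcnj a * qinner (S y) x
        = qinner x (S y) * a + qcnj a * qinner y (S x)"
      by (simp add: S.add qbounded_ops_qscale[OF assms(1)] qinner_add_left qinner_add_right
          qinner_qscale_left qinner_qscale_right real algebra_simps)
    moreover have "qinner (S y) x = qcnj (qinner x (S y))" "qinner y (S x) = qcnj (qinner (S x) y)"
      by (rule qinner_commute)+
    ultimately have "d * a = qcnj a * (qcnj (qinner (S x) y) - qcnj (qinner x (S y)))"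
      by (simp add: d_def algebra_simps)
    then show ?thesis by (simp add: d_def qcnj_mult quat_eq_iff)
  qed
  then have "d = 0" by (rule quat_eq_0_if_all_multiples_real)
  then show ?thesis by (simp add: d_def)
qed

text \<open>For each r > 0 the indices with values at least r form initial segments for
  \<open>s\<close> and for \<open>t\<close>. They are finite and equally large, hence equal, and
  these segments determine the sequences.\<close>

lemma decseq_eqI_multiplicities:
  fixes s t :: "nat \<Rightarrow> real"
  assumes dec: "decseq s" "decseq t" and nonneg: "\<And>n. 0 \<le> s n" "\<And>n. 0 \<le> t n"
    and mult: "\<And>r. r > 0 \<Longrightarrow> finite {n. s n = r} \<and> card {n. s n = r} = card {n. t n = r}"
      "\<And>r. r > 0 \<Longrightarrow> finite {n. t n = r}"
    and lim: "t \<longlonglongrightarrow> 0"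
  shows "s = t"
proof -
  have level: "{n. r \<le> s n} = {n. r \<le> t n}" if r: "r > 0" for r
  proof -
    define V where "V = t ` {n. r \<le> t n}"
    obtain N where "\<And>n. n \<ge> N \<Longrightarrow> t n < r"
      using order_tendstoD(2)[OF lim r] by (auto simp: eventually_sequentially)
    then have "{n. r \<le> t n} \<subseteq> {..<N}" by (auto simp: not_le[symmetric])
    then have finV: "finite V" and fint: "finite {n. r \<le> t n}"
      by (auto simp: V_def intro: finite_subset)
    have Vpos: "v > 0" if "v \<in> V" for v using that r by (auto simp: V_def)
    have t_UN: "{n. r \<le> t n} = (\<Union>v\<in>V. {n. t n = v})" by (auto simp: V_def)
    \<comment> \<open>Nothing is assumed about the limit of \<open>s\<close>. A value
      \<open>s n\<close> \<ge> r has positive multiplicity, so \<open>t\<close> takes it too, which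
      confines it to the finite set \<open>V\<close>.\<close>
    have "s n \<in> V" if "r \<le> s n" for n
    proof -
      have "0 < card {k. s k = s n}" using mult(1)[of "s n"] that r by (subst card_gt_0_iff) auto
      also have "\<dots> = card {k. t k = s n}" using mult(1)[of "s n"] that r by simp
      finally have "{k. t k = s n} \<noteq> {}" by force
      then obtain k where "t k = s n" by blast
      then show ?thesis unfolding V_def using that by (intro image_eqI[of _ _ k]) auto
    qed
    then have s_UN: "{n. r \<le> s n} = (\<Union>v\<in>V. {n. s n = v})" by (auto simp: V_def)
    have fins: "finite {n. r \<le> s n}" unfolding s_UN using finV mult(1) Vpos by auto
    have "card {n. r \<le> s n} = (\<Sum>v\<in>V. card {n. s n = v})"
      unfolding s_UN using finV mult(1) Vpos by (intro card_UN_disjoint) auto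
    also have "\<dots> = (\<Sum>v\<in>V. card {n. t n = v})"
      using mult(1) Vpos by (intro sum.cong) auto
    also have "\<dots> = card {n. r \<le> t n}"
      unfolding t_UN using finV mult(2) Vpos by (intro card_UN_disjoint[symmetric]) auto
    finally have card_eq: "card {n. r \<le> s n} = card {n. r \<le> t n}" .
    have "{n. r \<le> s n} \<subseteq> {n. r \<le> t n} \<or> {n. r \<le> t n} \<subseteq> {n. r \<le> s n}"
    proof (rule ccontr)
      assume "\<not> ?thesis"
      then obtain m n where mn: "r \<le> s m" "\<not> r \<le> t m" "r \<le> t n" "\<not> r \<le> s n" by auto
      show False
      proof (cases "m \<le> n")
        case True
        with decseqD[OF dec(2), of m n] mn show False by linarith
      next
        case False
        with decseqD[OF dec(1), of n m] mn show False by linarith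
      qed
    qed
    then show ?thesis
      using card_subset_eq[OF fint, of "{n. r \<le> s n}"] card_subset_eq[OF fins, of "{n. r \<le> t n}"]
        card_eq by auto
  qed
  show ?thesis
  proof
    fix n
    have "s n \<ge> t n" if "t n > 0" using level[OF that] by auto
    moreover have "t n \<ge> s n" if "s n > 0" using level[OF that] by auto
    ultimately show "s n = t n" using nonneg[of n] by force
  qed
qed

section \<open>Operators diagonal in a singular system\<close>

context singular_system
begin

abbreviation s :: "nat \<Rightarrow> real" where "s n \<equiv> norm (T (e n))"

text \<open>The constant sequence 1 gives the orthogonal projection onto the closed right span of
  the \<open>e n\<close>; the sequences \<open>s\<close> and its square give |T| and T*T.\<close>

definition diag :: "(nat \<Rightarrow> real) \<Rightarrow> 'h \<Rightarrow> 'h" where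
  "diag c x = (\<Sum>n. e n \<cdot>\<^sub>Q (of_real (c n) * qinner (e n) x))"

lemma qbounded: "T \<in> \<B>"
  by (rule qcompact_ops_qbounded[OF compact])

interpretation T: bounded_linear T
  by (rule qbounded_ops_linear[OF qbounded])

interpretation T': bounded_linear "qadjoint T"
  by (rule qbounded_ops_linear[OF qadjoint_qbounded[OF qbounded]])

lemma norm_e_le: "norm (e n) \<le> 1"
  using norm_0_or_1[of n] by auto

lemma qinner_T_T: "m \<noteq> n \<Longrightarrow> qinner (T (e m)) (T (e n)) = 0"
  using orth[of m n] eigenvector[of m]
  by (simp add: qinner_scaleR_left flip: qinner_qadjoint_comp(1)[OF qbounded])

lemma s_decseq: "decseq s"
proof (rule decseq_SucI)
  fix n
  \<comment> \<open>\<open>e (Suc n)\<close> is orthogonal to all \<open>e m\<close> with m < n,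
    hence a competitor at stage \<open>n\<close>.\<close>
  have "s (Suc n) \<le> s n * norm (e (Suc n))"
    by (rule maximal) (use orth in simp)
  also have "\<dots> \<le> s n * 1" by (intro mult_left_mono norm_e_le) simp
  finally show "s (Suc n) \<le> s n" by simp
qed

text \<open>The vectors \<open>T (e n)\<close> are mutually orthogonal, so a subsequential limit is
  orthogonal to every term of its subsequence, hence to itself, and is 0. Monotonicity extends this
  to the whole sequence.\<close>

lemma s_tendsto_0: "s \<longlonglongrightarrow> 0"
proof -
  obtain l r where r: "strict_mono r" and l: "(\<lambda>n. T (e (r n))) \<longlonglongrightarrow> l"
    using qcompact_ops_subsequence[OF compact, of e] norm_e_le by blast
  have "qinner (T (e (r m))) l = 0" for m
  proof -
    have "(\<lambda>n. qinner (T (e (r m))) (T (e (r n)))) \<longlonglongrightarrow> qinner (T (e (r m))) l"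
      by (rule bounded_linear.tendsto[OF bounded_linear_qinner_right l])
    moreover have "\<forall>\<^sub>F n in sequentially. qinner (T (e (r m))) (T (e (r n))) = 0"
      using eventually_gt_at_top[of m]
      by eventually_elim (use r in \<open>auto intro!: qinner_T_T simp: strict_mono_eq\<close>)
    ultimately show ?thesis by (rule LIMSEQ_unique[OF _ tendsto_eventually])
  qed
  then have "(\<lambda>m. 0 :: quat) \<longlonglongrightarrow> qinner l l"
    using bounded_linear.tendsto[OF bounded_linear_qinner_left l, of l] by simp
  then have "qinner l l = 0" by (simp add: LIMSEQ_const_iff)
  then have "l = 0" by (simp add: qinner_self_eq_zero_iff)
  with tendsto_norm[OF l] have sub: "(s \<circ> r) \<longlonglongrightarrow> 0" by (simp add: o_def)
  obtain L where L: "s \<longlonglongrightarrow> L"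
    using decseq_convergent[OF s_decseq, of 0] by auto
  from LIMSEQ_unique[OF LIMSEQ_subseq_LIMSEQ[OF L r] sub] L show ?thesis by simp
qed

lemma s_le: "s n \<le> s 0"
  using decseqD[OF s_decseq, of 0 n] by simp

text \<open>Such an \<open>x\<close> competes at every stage, so \<open>norm (T x)\<close> is at
  most \<open>s n * norm x\<close> for all \<open>n\<close>.\<close>

lemma T_eq_0_if_orthogonal:
  assumes "\<And>n. qinner (e n) x = 0"
  shows "T x = 0"
proof -
  have "(\<lambda>n. s n * norm x) \<longlonglongrightarrow> 0 * norm x" by (intro tendsto_intros s_tendsto_0)
  moreover have "norm (T x) \<le> s n * norm x" for n using assms by (intro maximal)
  ultimately have "norm (T x) \<le> 0 * norm x" by (intro LIMSEQ_le_const) auto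
  then show ?thesis by simp
qed

lemma bessel_e: "finite F \<Longrightarrow> (\<Sum>n\<in>F. (norm (qinner (e n) x))\<^sup>2) \<le> (norm x)\<^sup>2"
  by (rule bessel_inequality) (auto simp: orth norm_e_le)

lemma summable_coefficients: "summable (\<lambda>n. (norm (qinner (e n) x))\<^sup>2)"
  and suminf_coefficients_le: "(\<Sum>n. (norm (qinner (e n) x))\<^sup>2) \<le> (norm x)\<^sup>2"
proof -
  show "summable (\<lambda>n. (norm (qinner (e n) x))\<^sup>2)"
    by (rule bounded_imp_summable[where B = "(norm x)\<^sup>2"]) (auto intro: bessel_e)
  then show "(\<Sum>n. (norm (qinner (e n) x))\<^sup>2) \<le> (norm x)\<^sup>2"
    by (rule suminf_le_const) (auto intro: bessel_e)
qed

context
  fixes c :: "nat \<Rightarrow> real" and C :: real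
  assumes c: "\<And>n. \<bar>c n\<bar> \<le> C"
begin

lemma diag_summable: "summable (\<lambda>n. e n \<cdot>\<^sub>Q (of_real (c n) * qinner (e n) x))"
  and norm_diag_le: "norm (diag c x) \<le> C * norm x"
proof -
  define v where "v n = e n \<cdot>\<^sub>Q (of_real (c n) * qinner (e n) x)" for n
  have C: "0 \<le> C" using c[of 0] by linarith
  have le: "(norm (v n))\<^sup>2 \<le> C\<^sup>2 * (norm (qinner (e n) x))\<^sup>2" for n
  proof -
    have "norm (v n) \<le> 1 * (C * norm (qinner (e n) x))"
      unfolding v_def norm_qscale norm_mult
      by (intro mult_mono norm_e_le) (use c[of n] C in auto)
    then show ?thesis by (simp flip: power_mult_distrib) (simp add: power_mono)
  qed
  have sm: "summable (\<lambda>n. C\<^sup>2 * (norm (qinner (e n) x))\<^sup>2)"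
    by (intro summable_mult summable_coefficients)
  have sq: "summable (\<lambda>n. (norm (v n))\<^sup>2)"
    by (rule summable_comparison_test'[OF sm]) (use le in simp)
  have orth_v: "inner (v m) (v n) = 0" if "m \<noteq> n" for m n
    using that by (simp add: v_def inner_eq_qRe_qinner qinner_qscale_left qinner_qscale_right orth)
  show "summable v" by (rule orthogonal_series_summable(1)[OF orth_v sq])
  have "(norm (suminf v))\<^sup>2 \<le> (\<Sum>n. (norm (v n))\<^sup>2)"
    by (rule orthogonal_series_summable(2)[OF orth_v sq])
  also have "\<dots> \<le> (\<Sum>n. C\<^sup>2 * (norm (qinner (e n) x))\<^sup>2)" by (intro suminf_le le sq sm)
  also have "\<dots> = C\<^sup>2 * (\<Sum>n. (norm (qinner (e n) x))\<^sup>2)"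
    by (intro suminf_mult summable_coefficients)
  also have "\<dots> \<le> C\<^sup>2 * (norm x)\<^sup>2" by (intro mult_left_mono suminf_coefficients_le) simp
  finally have "(norm (suminf v))\<^sup>2 \<le> (C * norm x)\<^sup>2" by (simp add: power_mult_distrib)
  then show "norm (diag c x) \<le> C * norm x"
    using C by (auto simp: diag_def v_def[abs_def] intro: power2_le_imp_le)
qed

lemma diag_sums: "(\<lambda>n. e n \<cdot>\<^sub>Q (of_real (c n) * qinner (e n) x)) sums diag c x"
  unfolding diag_def by (rule summable_sums[OF diag_summable])

lemma qinner_diag_sums:
  "(\<lambda>n. qinner y (e n) * (of_real (c n) * qinner (e n) x)) sums qinner y (diag c x)"
  using bounded_linear.sums[OF bounded_linear_qinner_right diag_sums]
  by (simp only: qinner_qscale_right)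

lemma qinner_e_diag: "qinner (e m) (diag c x) = of_real (c m) * qinner (e m) x"
proof -
  have "(\<lambda>n. qinner (e m) (e n) * (of_real (c n) * qinner (e n) x)) sums
      (qinner (e m) (e m) * (of_real (c m) * qinner (e m) x))"
    using sums_finite[of "{m}" "\<lambda>n. qinner (e m) (e n) * (of_real (c n) * qinner (e n) x)"]
    by (simp add: orth)
  from sums_unique2[OF qinner_diag_sums this] show ?thesis
    using norm_0_or_1[of m] by (auto simp: qinner_self)
qed

lemma diag_e: "diag c (e m) = c m *\<^sub>R e m"
proof -
  have "(\<lambda>n. e n \<cdot>\<^sub>Q (of_real (c n) * qinner (e n) (e m))) sums
      (e m \<cdot>\<^sub>Q (of_real (c m) * qinner (e m) (e m)))"
    using sums_finite[of "{m}" "\<lambda>n. e n \<cdot>\<^sub>Q (of_real (c n) * qinner (e n) (e m))"]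
    by (simp add: orth)
  from sums_unique2[OF diag_sums this] show ?thesis
    using norm_0_or_1[of m] by (auto simp: qinner_self qscale_of_real)
qed

lemma diag_qbounded: "diag c \<in> \<B>"
proof (rule qbounded_opsI)
  show "bounded_linear (diag c)"
  proof (rule bounded_linear_intro[where K = C])
    show "diag c (x + y) = diag c x + diag c y" for x y
      by (rule sums_unique2[OF diag_sums])
        (use sums_add[OF diag_sums diag_sums] in \<open>simp add: qinner_add_right distrib_left qscale_add_right\<close>)
    show "diag c (r *\<^sub>R x) = r *\<^sub>R diag c x" for r x
      by (rule sums_unique2[OF diag_sums])
        (use sums_scaleR_right[OF diag_sums] in
          \<open>simp add: qinner_scaleR_right linear_scale[OF bounded_linear.linear[OF bounded_linear_qscale_right]]\<close>)
    show "norm (diag c x) \<le> norm x * C" for x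
      using norm_diag_le[of x] by (simp add: mult.commute)
  qed
  show "diag c (x \<cdot>\<^sub>Q a) = diag c x \<cdot>\<^sub>Q a" for x a
    by (rule sums_unique2[OF diag_sums])
      (use bounded_linear.sums[OF bounded_linear_qscale_left diag_sums] in
        \<open>simp add: qinner_qscale_right qscale_qscale mult.assoc\<close>)
qed

lemma diag_qpositive:
  assumes "\<And>n. 0 \<le> c n"
  shows "qpositive (diag c)"
  unfolding qpositive_def
proof
  fix x
  have eq: "qinner x (e n) * (of_real (c n) * qinner (e n) x)
      = of_real (c n * (norm (qinner (e n) x))\<^sup>2)" for n
  proof -
    have "qinner x (e n) * (of_real (c n) * qinner (e n) x)
        = of_real (c n) * (qcnj (qinner (e n) x) * qinner (e n) x)"
      by (subst qinner_commute[of x]) (metis mult.assoc quat_of_real_commute)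
    then show ?thesis by (simp add: qcnj_mult_self)
  qed
  have sums: "(\<lambda>n. of_real (c n * (norm (qinner (e n) x))\<^sup>2)) sums qinner x (diag c x)"
    using qinner_diag_sums[of x x] by (simp only: eq)
  \<comment> \<open>Taking real parts gives a real series with nonnegative sum. Embedding it again
    with \<open>of_real\<close> shows that the quaternionic sum has no imaginary part.\<close>
  have "bounded_linear qRe"
    by (rule bounded_linear_intro[where K = 1])
      (use norm_quat_power2 in \<open>auto intro!: abs_le_square_iff[THEN iffD2, of _ "norm _", simplified]\<close>)
  from bounded_linear.sums[OF this sums]
  have re: "(\<lambda>n. c n * (norm (qinner (e n) x))\<^sup>2) sums qRe (qinner x (diag c x))"
    by simp
  then have "0 \<le> qRe (qinner x (diag c x))"
    by (rule sums_le[OF _ sums_zero, rotated]) (use assms in simp)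
  moreover from sums_unique2[OF sums sums_of_real[OF re]]
  have "qinner x (diag c x) = of_real (qRe (qinner x (diag c x)))" .
  ultimately show "\<exists>r\<ge>0. qinner x (diag c x) = of_real r" by blast
qed

end

lemma qinner_e_remainder: "qinner (e n) (x - diag (\<lambda>_. 1) x) = 0"
  using qinner_e_diag[of "\<lambda>_. 1" 1 n x] by (simp add: qinner_diff_right)

text \<open>\<open>S\<close> annihilates the part of \<open>x\<close> outside the closed span of the
  \<open>e n\<close>, and by continuity it can be applied term by term to the projection of
  \<open>x\<close>.\<close>

lemma expansion_sums:
  assumes "S \<in> \<B>" "\<And>x. (\<And>n. qinner (e n) x = 0) \<Longrightarrow> S x = 0"
  shows "(\<lambda>n. S (e n) \<cdot>\<^sub>Q qinner (e n) x) sums S x"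
proof -
  interpret S: bounded_linear S by (rule qbounded_ops_linear[OF assms(1)])
  have "S (x - diag (\<lambda>_. 1) x) = 0" by (intro assms(2) qinner_e_remainder)
  then have "S x = S (diag (\<lambda>_. 1) x)" by (simp add: S.diff)
  moreover have "(\<lambda>n. S (e n \<cdot>\<^sub>Q (of_real 1 * qinner (e n) x))) sums S (diag (\<lambda>_. 1) x)"
    by (intro S.sums diag_sums[of _ 1]) simp
  ultimately show ?thesis by (simp add: qbounded_ops_qscale[OF assms(1)])
qed

lemma diag_eqI:
  assumes S: "S \<in> \<B>" "\<And>x. (\<And>n. qinner (e n) x = 0) \<Longrightarrow> S x = 0"
    and c: "\<And>n. S (e n) = c n *\<^sub>R e n"
  shows "S x = diag c x"
proof -
  have "S (e n) \<cdot>\<^sub>Q qinner (e n) x = e n \<cdot>\<^sub>Q (of_real (c n) * qinner (e n) x)" for n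
    by (simp only: c qscale_of_real[symmetric] qscale_qscale)
  then show ?thesis
    using expansion_sums[OF S, of x] by (simp add: sums_iff diag_def)
qed

lemma qadjoint_comp_eq_diag: "qadjoint T (T x) = diag (\<lambda>n. (s n)\<^sup>2) x"
proof -
  have "(qadjoint T \<circ> T) x = diag (\<lambda>n. (s n)\<^sup>2) x"
  proof (rule diag_eqI)
    show "qadjoint T \<circ> T \<in> \<B>"
      by (rule qbounded_opsI)
        (simp_all add: o_def bounded_linear_compose[OF T'.bounded_linear_axioms T.bounded_linear_axioms]
          qbounded_ops_qscale[OF qbounded] qbounded_ops_qscale[OF qadjoint_qbounded[OF qbounded]])
  qed (simp_all add: eigenvector T_eq_0_if_orthogonal T'.zero)
  then show ?thesis by simp
qed

text \<open>The uniqueness half needs no functional calculus. A positive square root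
  \<open>S\<close> of T*T vanishes on the kernel of \<open>T\<close>, since (norm (S x))^2 is the
  product of \<open>x\<close> with T*T x, and so \<open>S\<close> is determined by its values on the
  \<open>e n\<close>.\<close>

lemma op_abs_eq_diag: "op_abs T = diag s"
  unfolding op_abs_def op_sqrt_def
proof (rule the_equality)
  have sb: "\<bar>s n\<bar> \<le> s 0" for n using s_le[of n] by simp
  have "diag s \<circ> diag s = qadjoint T \<circ> T"
  proof
    fix x
    have "diag s (diag s x) = diag (\<lambda>n. (s n)\<^sup>2) x"
      unfolding diag_def[of s "diag s x"] qinner_e_diag[of s, OF sb]
      by (simp add: diag_def power2_eq_square mult.assoc)
    then show "(diag s \<circ> diag s) x = (qadjoint T \<circ> T) x" by (simp add: qadjoint_comp_eq_diag)
  qed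
  then show "diag s \<in> \<B> \<and> qpositive (diag s) \<and> diag s \<circ> diag s = qadjoint T \<circ> T"
    using diag_qbounded[of s, OF sb] diag_qpositive[of s, OF sb] by simp
next
  fix S assume "S \<in> \<B> \<and> qpositive S \<and> S \<circ> S = qadjoint T \<circ> T"
  then have S: "S \<in> \<B>" "qpositive S" and SS: "\<And>x. S (S x) = qadjoint T (T x)"
    by (auto simp: fun_eq_iff)
  interpret S: bounded_linear S by (rule qbounded_ops_linear[OF S(1)])
  have ker: "S x = 0" if "T x = 0" for x
  proof -
    have "qinner (S x) (S x) = qinner x (S (S x))" by (rule qpositive_imp_selfadjoint[OF S])
    then have "qinner (S x) (S x) = 0" using that by (simp add: SS T'.zero)
    then show ?thesis by (simp add: qinner_self_eq_zero_iff)
  qed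
  have "S (e n) = s n *\<^sub>R e n" for n
  proof (cases "s n = 0")
    case True
    then show ?thesis using ker by simp
  next
    case False
    \<comment> \<open>(S + s n)(S - s n) annihilates \<open>e n\<close>, so \<open>w\<close>
      satisfies S w = - s n w. Positivity of \<open>S\<close> and s n > 0 force
      \<open>w = 0\<close>.\<close>
    define w where "w = S (e n) - s n *\<^sub>R e n"
    have "S w = - (s n *\<^sub>R w)"
      by (simp add: w_def S.diff S.scaleR SS eigenvector scaleR_diff_right power2_eq_square)
    then have "qinner w (S w) = of_real (- (s n * (norm w)\<^sup>2))"
      by (simp add: qinner_minus_right qinner_scaleR_right qinner_self scaleR_conv_of_real)
    moreover obtain r where "r \<ge> 0" "qinner w (S w) = of_real r"
      using S(2) by (auto simp: qpositive_def)
    ultimately have "s n * (norm w)\<^sup>2 \<le> 0" by (simp only: of_real_eq_iff)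
    then have "w = 0" using False by (simp add: mult_le_0_iff)
    then show ?thesis by (simp add: w_def)
  qed
  then show "S = diag s"
    by (intro ext diag_eqI S(1) ker T_eq_0_if_orthogonal)
qed

lemma finite_multiplicity:
  assumes "r > 0"
  shows "finite {n. s n = r}"
proof -
  obtain N where "\<And>n. n \<ge> N \<Longrightarrow> s n < r"
    using order_tendstoD(2)[OF s_tendsto_0 assms] by (auto simp: eventually_sequentially)
  then have "{n. s n = r} \<subseteq> {..<N}" by (force simp: not_le[symmetric])
  then show ?thesis by (rule finite_subset) simp
qed

text \<open>Positivity of \<open>r\<close> ensures that each \<open>e n\<close> with
  \<open>s n = r\<close> is a unit vector and not padding, and it allows division by
  \<open>r\<close> when an eigenvector is expanded.\<close>

lemma qdim_eigenspace:
  assumes r: "r > 0"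
  shows "qdim (qeigenspace (op_abs T) r) = card {n. s n = r}"
proof -
  define N where "N = {n. s n = r}"
  have sb: "\<bar>s n\<bar> \<le> s 0" for n using s_le[of n] by simp
  have finN: "finite N" unfolding N_def by (rule finite_multiplicity[OF r])
  have unit: "qinner (e m) (e n) = (if m = n then 1 else 0)" if "m \<in> N" for m n
  proof -
    have "e m \<noteq> 0" using that r by (auto simp: N_def T.zero)
    then have "norm (e m) = 1" using norm_0_or_1[of m] by blast
    then show ?thesis by (auto simp: qinner_self orth)
  qed
  have inj: "inj_on e N"
    by (rule inj_onI) (metis unit zero_neq_one)
  have unit': "qinner a b = (if a = b then 1 else 0)" if ab: "a \<in> e ` N" "b \<in> e ` N" for a b
  proof -
    obtain m n where "m \<in> N" "n \<in> N" "a = e m" "b = e n" using ab by blast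
    then show ?thesis using unit[of m n] inj by (auto simp: inj_on_eq_iff)
  qed
  have "qdim (qeigenspace (op_abs T) r) = card (e ` N)"
  proof (rule qdim_eqI)
    show "e ` N \<subseteq> qeigenspace (op_abs T) r"
      unfolding op_abs_eq_diag qeigenspace_def
      by (auto simp: N_def diag_e[of s, OF sb] qscale_of_real)
    show "qindependent (e ` N)"
      unfolding qindependent_def
    proof (intro allI impI ballI)
      fix F c b
      assume F: "finite F" "F \<subseteq> e ` N" "(\<Sum>b\<in>F. b \<cdot>\<^sub>Q c b) = 0" "b \<in> F"
      have "0 = qinner b (\<Sum>b\<in>F. b \<cdot>\<^sub>Q c b)" by (simp add: F)
      also have "\<dots> = (\<Sum>a\<in>F. if b = a then c b else 0)"
        unfolding qinner_sum_right qinner_qscale_right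
      proof (intro sum.cong refl)
        fix a assume "a \<in> F"
        with F have "a \<in> e ` N" "b \<in> e ` N" by auto
        then show "qinner b a * c a = (if b = a then c b else 0)"
          using unit'[of b a] by auto
      qed
      also have "\<dots> = c b" using F by simp
      finally show "c b = 0" by simp
    qed
    show "qeigenspace (op_abs T) r \<subseteq> qspan (e ` N)"
    proof
      fix x assume "x \<in> qeigenspace (op_abs T) r"
      then have x: "diag s x = r *\<^sub>R x"
        by (simp add: op_abs_eq_diag qeigenspace_def qscale_of_real)
      \<comment> \<open>Comparing the coefficients of \<open>diag s x = r *\<^sub>R x\<close> along
        \<open>e n\<close> leaves only indices with \<open>s n = r\<close>.\<close>
      have z: "qinner (e n) x = 0" if "n \<notin> N" for n
      proof -
        have "s n *\<^sub>R qinner (e n) x = r *\<^sub>R qinner (e n) x"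
          using qinner_e_diag[of s "s 0" n x, OF sb] by (auto simp: x qinner_scaleR_right scaleR_conv_of_real)
        then show ?thesis using that by (auto simp: N_def)
      qed
      have "diag s x = (\<Sum>n\<in>N. e n \<cdot>\<^sub>Q (of_real (s n) * qinner (e n) x))"
        unfolding diag_def using finN z by (intro suminf_finite) auto
      also have "\<dots> = (\<Sum>n\<in>N. r *\<^sub>R (e n \<cdot>\<^sub>Q qinner (e n) x))"
        by (intro sum.cong refl)
          (simp add: N_def linear_scale[OF bounded_linear.linear[OF bounded_linear_qscale_right]]
            flip: scaleR_conv_of_real)
      finally have "r *\<^sub>R x = r *\<^sub>R (\<Sum>n\<in>N. e n \<cdot>\<^sub>Q qinner (e n) x)"
        by (simp add: x scaleR_sum_right)
      then have "x = (\<Sum>b\<in>e ` N. b \<cdot>\<^sub>Q qinner b x)"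
        using r by (simp add: sum.reindex[OF inj])
      then show "x \<in> qspan (e ` N)"
        unfolding qspan_def using finN
        by (intro CollectI exI[of _ "e ` N"] exI[of _ "\<lambda>b. qinner b x"]) simp
    qed
  qed (use finN in simp)
  then show ?thesis using card_image[OF inj] by (simp add: N_def)
qed

lemma singular_values_eq: "singular_values T = s"
  unfolding singular_values_def
proof (rule the_equality)
  show "decseq s \<and> (\<forall>n. 0 \<le> s n) \<and>
     (\<forall>r>0. finite {n. s n = r} \<and> card {n. s n = r} = qdim (qeigenspace (op_abs T) r))"
    using s_decseq finite_multiplicity qdim_eigenspace by simp
next
  fix t :: "nat \<Rightarrow> real"
  assume "decseq t \<and> (\<forall>n. 0 \<le> t n) \<and>
     (\<forall>r>0. finite {n. t n = r} \<and> card {n. t n = r} = qdim (qeigenspace (op_abs T) r))"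
  then show "t = s"
    using s_decseq finite_multiplicity qdim_eigenspace s_tendsto_0
    by (intro decseq_eqI_multiplicities) auto
qed

end

section \<open>The Schatten norm as a supremum\<close>

text \<open>Jensen's inequality for weights of total mass A \<le> 1: after normalising by A, the
  correction factor A^p / A is at most 1 because p \<ge> 1. Restricting to nonzero terms makes the
  points and A positive.\<close>

lemma powr_subconvex_sum:
  fixes a y :: "'a \<Rightarrow> real"
  assumes S: "finite S" and a: "\<And>k. k \<in> S \<Longrightarrow> 0 \<le> a k" "sum a S \<le> 1"
    and y: "\<And>k. k \<in> S \<Longrightarrow> 0 \<le> y k" and p: "1 \<le> p"
  shows "(\<Sum>k\<in>S. a k * y k) powr p \<le> (\<Sum>k\<in>S. a k * y k powr p)"
proof -
  define S' where "S' = {k \<in> S. a k * y k \<noteq> 0}"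
  have fin: "finite S'" using S by (simp add: S'_def)
  have pos: "a k > 0" "y k > 0" if "k \<in> S'" for k
    using that a(1) y by (auto simp: S'_def order.strict_iff_order)
  have eqs: "(\<Sum>k\<in>S. a k * y k) = (\<Sum>k\<in>S'. a k * y k)"
    "(\<Sum>k\<in>S. a k * y k powr p) = (\<Sum>k\<in>S'. a k * y k powr p)"
    using S by (auto simp: S'_def intro!: sum.mono_neutral_right)
  show ?thesis
  proof (cases "S' = {}")
    case False
    define A where "A = sum a S'"
    have A: "A > 0" unfolding A_def using fin False pos by (intro sum_pos) auto
    have "A \<le> 1"
      using a S sum_mono2[OF S, of S' a] by (force simp: A_def S'_def)
    have "(\<Sum>k\<in>S'. (a k / A) *\<^sub>R y k) powr p \<le> (\<Sum>k\<in>S'. (a k / A) * y k powr p)"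
      using fin False A pos
      by (intro convex_on_sum[OF _ _ powr_convex[OF p]])
        (auto simp: A_def less_imp_le simp flip: sum_divide_distrib)
    moreover have "(\<Sum>k\<in>S'. (a k / A) *\<^sub>R y k) = (\<Sum>k\<in>S'. a k * y k) / A"
      by (simp add: sum_divide_distrib)
    moreover have "(\<Sum>k\<in>S'. (a k / A) * y k powr p) = (\<Sum>k\<in>S'. a k * y k powr p) / A"
      by (simp add: sum_divide_distrib)
    moreover have nonneg: "0 \<le> (\<Sum>k\<in>S'. a k * y k)" "0 \<le> (\<Sum>k\<in>S'. a k * y k powr p)"
      using pos by (auto intro!: sum_nonneg simp: less_imp_le)
    ultimately have "(\<Sum>k\<in>S'. a k * y k) powr p / A powr p \<le> (\<Sum>k\<in>S'. a k * y k powr p) / A"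
      using A by (simp add: powr_divide)
    then have "(\<Sum>k\<in>S'. a k * y k) powr p \<le> (\<Sum>k\<in>S'. a k * y k powr p) / A * A powr p"
      using A by (simp add: pos_divide_le_eq)
    also have "\<dots> \<le> (\<Sum>k\<in>S'. a k * y k powr p) / A * A powr 1"
      using A \<open>A \<le> 1\<close> p nonneg by (intro mult_left_mono powr_mono') auto
    also have "\<dots> = (\<Sum>k\<in>S'. a k * y k powr p)" using A by simp
    finally show ?thesis by (simp only: eqs)
  next
    case True
    then show ?thesis unfolding eqs by simp
  qed
qed

lemma norm_qinner_commute: "norm (qinner x y) = norm (qinner y x)"
  by (subst qinner_commute) simp

text \<open>From 2 a b \<le> a^2 + b^2 and two uses of Bessel. It serves for the rows, with the
  singular vectors as families, and for the columns, with the given orthonormal sets as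
  families.\<close>

lemma sum_product_qinner_le:
  fixes a b :: "nat \<Rightarrow> 'h::quaternionic_hilbert_space"
  assumes "finite F"
    and "\<And>m n. m \<in> F \<Longrightarrow> n \<in> F \<Longrightarrow> m \<noteq> n \<Longrightarrow> qinner (a m) (a n) = 0"
      "\<And>n. n \<in> F \<Longrightarrow> norm (a n) \<le> 1"
    and "\<And>m n. m \<in> F \<Longrightarrow> n \<in> F \<Longrightarrow> m \<noteq> n \<Longrightarrow> qinner (b m) (b n) = 0"
      "\<And>n. n \<in> F \<Longrightarrow> norm (b n) \<le> 1"
    and x: "norm x \<le> 1" and y: "norm y \<le> 1"
  shows "(\<Sum>n\<in>F. norm (qinner (a n) x) * norm (qinner (b n) y)) \<le> 1"
proof -
  have "(\<Sum>n\<in>F. 2 * (norm (qinner (a n) x) * norm (qinner (b n) y)))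
      \<le> (\<Sum>n\<in>F. (norm (qinner (a n) x))\<^sup>2 + (norm (qinner (b n) y))\<^sup>2)"
    by (intro sum_mono) (metis sum_squares_bound mult.assoc)
  also have "\<dots> \<le> (norm x)\<^sup>2 + (norm y)\<^sup>2"
    unfolding sum.distrib by (intro add_mono bessel_inequality assms)
  also have "\<dots> \<le> 1 + 1"
    using x y by (intro add_mono power_le_one) auto
  finally show ?thesis by (simp flip: sum_distrib_left)
qed

lemma qorthonormal_onD:
  assumes "qorthonormal_on N e"
  shows "m \<in> N \<Longrightarrow> n \<in> N \<Longrightarrow> m \<noteq> n \<Longrightarrow> qinner (e m) (e n) = 0"
    and "n \<in> N \<Longrightarrow> norm (e n) = 1"
proof -
  show "norm (e n) = 1" if "n \<in> N"
    using assms that by (simp add: qorthonormal_on_def norm_eq_sqrt_qinner)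
qed (use assms in \<open>auto simp: qorthonormal_on_def\<close>)

section \<open>The power sum estimate and its equality case\<close>

context singular_system
begin

text \<open>For \<open>s n = 0\<close> division yields the zero vector, so \<open>T_e\<close>,
  orthogonality and the norm bound hold for every index.\<close>

definition left_vec :: "nat \<Rightarrow> 'h" where
  "left_vec n = T (e n) /\<^sub>R s n"

lemma T_e: "T (e n) = s n *\<^sub>R left_vec n"
  by (cases "s n = 0") (simp_all add: left_vec_def)

lemma left_vec_orth: "m \<noteq> n \<Longrightarrow> qinner (left_vec m) (left_vec n) = 0"
  by (simp add: left_vec_def qinner_scaleR_left qinner_scaleR_right qinner_T_T)

lemma norm_left_vec_le: "norm (left_vec n) \<le> 1"
  by (cases "s n = 0") (simp_all add: left_vec_def)

text \<open>The coefficients \<open>|\<langle>\<sigma>\<^sub>n, f\<^sub>k\<rangle>| |\<langle>e\<^sub>k, u\<^sub>n\<rangle>|\<close> with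
  \<open>f\<^sub>k = T e\<^sub>k / s\<^sub>k\<close> form a doubly substochastic matrix: Bessel's
  inequality bounds its rows and its columns.\<close>

lemma sum_powr_le:
  assumes F: "finite F" "F \<subseteq> N" and u: "qorthonormal_on N u" and \<sigma>: "qorthonormal_on N \<sigma>"
    and p: "1 \<le> p"
  shows "(\<Sum>n\<in>F. ennreal (norm (qinner (\<sigma> n) (T (u n))) powr p)) \<le> (\<Sum>k. ennreal (s k powr p))"
proof -
  define a where "a n k = norm (qinner (left_vec k) (\<sigma> n)) * norm (qinner (e k) (u n))" for n k
  \<comment> \<open>The finite form of Jensen's inequality needs a truncation of the expansion of
    \<open>T (u n)\<close>. The bound does not depend on \<open>K\<close>, and \<open>F\<close> is
    finite, so the limit in \<open>K\<close> can be taken afterwards.\<close>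
  define t where "t n K = (\<Sum>k<K. qinner (\<sigma> n) (T (e k)) * qinner (e k) (u n))" for n K
  have FN: "n \<in> N" if "n \<in> F" for n using that F by blast
  have row: "(\<Sum>k<K. a n k) \<le> 1" if "n \<in> F" for n K
    unfolding a_def using qorthonormal_onD(2)[OF u FN[OF that]] qorthonormal_onD(2)[OF \<sigma> FN[OF that]]
    by (intro sum_product_qinner_le) (auto simp: orth left_vec_orth norm_e_le norm_left_vec_le)
  have col: "(\<Sum>n\<in>F. a n k) \<le> 1" for k
    unfolding a_def norm_qinner_commute[of "left_vec k"] norm_qinner_commute[of "e k"]
    using F(1) FN by (intro sum_product_qinner_le)
      (auto simp: qorthonormal_onD[OF u] qorthonormal_onD[OF \<sigma>] norm_e_le norm_left_vec_le)
  have partial: "(\<Sum>n\<in>F. norm (t n K) powr p) \<le> (\<Sum>k<K. s k powr p)" for K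
  proof -
    have "norm (t n K) powr p \<le> (\<Sum>k<K. a n k * s k powr p)" if "n \<in> F" for n
    proof -
      have "norm (t n K) \<le> (\<Sum>k<K. norm (qinner (\<sigma> n) (T (e k)) * qinner (e k) (u n)))"
        unfolding t_def by (rule norm_sum)
      also have "\<dots> = (\<Sum>k<K. a n k * s k)"
      proof (intro sum.cong refl)
        fix k
        have "norm (qinner (\<sigma> n) (T (e k))) = s k * norm (qinner (left_vec k) (\<sigma> n))"
          by (subst T_e) (simp add: qinner_scaleR_right norm_qinner_commute[of "left_vec k"])
        then show "norm (qinner (\<sigma> n) (T (e k)) * qinner (e k) (u n)) = a n k * s k"
          by (simp add: a_def norm_mult mult_ac)
      qed
      finally have "norm (t n K) powr p \<le> (\<Sum>k<K. a n k * s k) powr p"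
        using p by (intro powr_mono2) auto
      also have "\<dots> \<le> (\<Sum>k<K. a n k * s k powr p)"
        using p row[OF that] by (intro powr_subconvex_sum) (auto simp: a_def)
      finally show ?thesis .
    qed
    then have "(\<Sum>n\<in>F. norm (t n K) powr p) \<le> (\<Sum>n\<in>F. \<Sum>k<K. a n k * s k powr p)"
      by (rule sum_mono)
    also have "\<dots> = (\<Sum>k<K. (\<Sum>n\<in>F. a n k) * s k powr p)"
      by (subst sum.swap) (simp add: sum_distrib_right)
    also have "\<dots> \<le> (\<Sum>k<K. 1 * s k powr p)"
      by (intro sum_mono mult_right_mono col) simp
    finally show ?thesis by simp
  qed
  have bound: "ennreal (\<Sum>n\<in>F. norm (t n K) powr p) \<le> (\<Sum>k. ennreal (s k powr p))" for K
  proof -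
    have "ennreal (\<Sum>n\<in>F. norm (t n K) powr p) \<le> (\<Sum>k<K. ennreal (s k powr p))"
      using partial[of K] by (simp add: sum_ennreal ennreal_leI)
    also have "\<dots> \<le> (\<Sum>k. ennreal (s k powr p))" by (intro sum_le_suminf) auto
    finally show ?thesis .
  qed
  have "t n \<longlonglongrightarrow> qinner (\<sigma> n) (T (u n))" for n
  proof -
    have "(\<lambda>k. T (e k) \<cdot>\<^sub>Q qinner (e k) (u n)) sums T (u n)"
      by (rule expansion_sums[OF qbounded T_eq_0_if_orthogonal])
    from bounded_linear.sums[OF bounded_linear_qinner_right this]
    show ?thesis by (simp add: sums_def t_def[abs_def] qinner_qscale_right)
  qed
  \<comment> \<open>A limit may be 0, where continuity of the power rests on p > 0.\<close>
  then have "(\<lambda>K. \<Sum>n\<in>F. norm (t n K) powr p) \<longlonglongrightarrow> (\<Sum>n\<in>F. norm (qinner (\<sigma> n) (T (u n))) powr p)"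
    using p by (intro tendsto_sum tendsto_powr' tendsto_norm tendsto_const) auto
  then have "(\<lambda>K. ennreal (\<Sum>n\<in>F. norm (t n K) powr p))
      \<longlonglongrightarrow> ennreal (\<Sum>n\<in>F. norm (qinner (\<sigma> n) (T (u n))) powr p)"
    by (rule tendsto_ennrealI)
  then have "ennreal (\<Sum>n\<in>F. norm (qinner (\<sigma> n) (T (u n))) powr p) \<le> (\<Sum>k. ennreal (s k powr p))"
    by (rule LIMSEQ_le_const2) (use bound in blast)
  then show ?thesis by (simp add: sum_ennreal)
qed

lemma infsum_powr_le:
  assumes "qorthonormal_on N u" "qorthonormal_on N \<sigma>" "1 \<le> p"
  shows "(\<Sum>\<^sub>\<infinity>n\<in>N. ennreal (norm (qinner (\<sigma> n) (T (u n))) powr p)) \<le> (\<Sum>k. ennreal (s k powr p))"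
  by (subst nonneg_infsum_complete) (auto intro!: SUP_least sum_powr_le[OF _ _ assms] simp del: sum_ennreal)

text \<open>Only indices with \<open>s n\<close> \<noteq> 0 give unit vectors in both families. The
  omitted terms do not affect the sum because \<open>0 powr p = 0\<close>.\<close>

lemma infsum_powr_attained:
  shows "qorthonormal_on {n. s n \<noteq> 0} e" and "qorthonormal_on {n. s n \<noteq> 0} left_vec"
    and "(\<Sum>k. ennreal (s k powr p)) \<le>
      (\<Sum>\<^sub>\<infinity>n\<in>{n. s n \<noteq> 0}. ennreal (norm (qinner (left_vec n) (T (e n))) powr p))"
proof -
  let ?N = "{n. s n \<noteq> 0}"
  have e1: "qinner (e n) (e n) = 1" if "n \<in> ?N" for n
  proof -
    have "e n \<noteq> 0"
      using that linear_0[OF bounded_linear.linear[OF qbounded_ops_linear[OF qbounded]]] by auto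
    then show ?thesis using norm_0_or_1[of n] by (simp add: qinner_self)
  qed
  have f1: "qinner (left_vec n) (left_vec n) = 1" if "n \<in> ?N" for n
    using that by (simp add: qinner_self left_vec_def)
  show "qorthonormal_on ?N e" using e1 by (simp add: qorthonormal_on_def orth)
  show "qorthonormal_on ?N left_vec" using f1 by (simp add: qorthonormal_on_def left_vec_orth)
  have term_eq: "norm (qinner (left_vec n) (T (e n))) = s n" if "n \<in> ?N" for n
    using f1[OF that] by (subst T_e) (simp add: qinner_scaleR_right)
  have "(\<Sum>k<K. ennreal (s k powr p)) \<le>
      (\<Sum>\<^sub>\<infinity>n\<in>?N. ennreal (norm (qinner (left_vec n) (T (e n))) powr p))" for K
  proof -
    have "(\<Sum>k<K. ennreal (s k powr p)) = (\<Sum>n\<in>{..<K} \<inter> ?N. ennreal (s n powr p))"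
      by (rule sum.mono_neutral_right) auto
    also have "\<dots> = (\<Sum>n\<in>{..<K} \<inter> ?N. ennreal (norm (qinner (left_vec n) (T (e n))) powr p))"
      by (intro sum.cong) (auto simp: term_eq)
    also have "\<dots> \<le> (\<Sum>\<^sub>\<infinity>n\<in>?N. ennreal (norm (qinner (left_vec n) (T (e n))) powr p))"
      by (subst nonneg_infsum_complete) (auto intro!: SUP_upper)
    finally show ?thesis .
  qed
  then show "(\<Sum>k. ennreal (s k powr p)) \<le>
      (\<Sum>\<^sub>\<infinity>n\<in>?N. ennreal (norm (qinner (left_vec n) (T (e n))) powr p))"
    by (intro suminf_le_const) auto
qed

end

lemma ennreal_root_mono: "0 < p \<Longrightarrow> x \<le> y \<Longrightarrow> ennreal_root p x \<le> ennreal_root p y"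
  by (auto simp: ennreal_root_def top.not_eq_extremum top_unique
      intro!: ennreal_leI powr_mono2 enn2real_mono)

theorem theorem3p25:
  fixes J T :: "'h::quaternionic_hilbert_space \<Rightarrow> 'h" and i :: quat and p :: real
  assumes "separable_space (euclidean :: 'h topology)"
    and "J \<in> \<B>" and "anti_selfadjoint J" and "qunitary J"
    and "i \<in> \<S>"
    and "T \<in> \<B>\<^sub>0" and "op_commutator T J = (\<lambda>x. 0)"
    and "1 \<le> p"
  shows "(T \<in> schatten_class p J \<longleftrightarrow>
            (\<forall>(N, e, \<sigma>) \<in> orthonormal_pairs J i.
               (\<Sum>\<^sub>\<infinity>n\<in>N. ennreal (norm (qinner (\<sigma> n) (T (e n))) powr p)) < \<infinity>)) \<and>
         (qpositive T \<longrightarrow>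
            schatten_norm p T =
              (SUP (N, e, \<sigma>) \<in> orthonormal_pairs J i.
                 ennreal_root p (\<Sum>\<^sub>\<infinity>n\<in>N. ennreal (norm (qinner (\<sigma> n) (T (e n))) powr p))))"
proof -
  have TJ: "T (J x) = J (T x)" for x
    using assms(7) by (simp add: op_commutator_def fun_eq_iff)
  obtain e where sys: "singular_system T e" and e_H: "range e \<subseteq> H_plus J i"
    using singular_system_exists[OF assms(2-6) TJ] by blast
  interpret singular_system T e by (rule sys)
  define M where "M = (\<Sum>k. ennreal (s k powr p))"
  define X where "X = (\<lambda>(N :: nat set, e, \<sigma>). \<Sum>\<^sub>\<infinity>n\<in>N. ennreal (norm (qinner (\<sigma> n) (T (e n))) powr p))"
  have upper: "X x \<le> M" if "x \<in> orthonormal_pairs J i" for x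
    using that infsum_powr_le[OF _ _ assms(8)] by (auto simp: X_def M_def orthonormal_pairs_def)
  define x0 where "x0 = ({n. s n \<noteq> 0}, e, left_vec)"
  \<comment> \<open>\<open>T\<close> commutes with \<open>J\<close> and is right linear, so it
    preserves the slice; the normalising factor is real and stays in it.\<close>
  have "left_vec n \<in> H_plus J i" for n
  proof -
    note lin = bounded_linear.linear[OF qbounded_ops_linear[OF assms(2)]]
      bounded_linear.linear[OF bounded_linear_qscale_left]
    have "J (e n) = e n \<cdot>\<^sub>Q i" using e_H by (auto simp: H_plus_def)
    then have "J (T (e n)) = T (e n) \<cdot>\<^sub>Q i"
      by (simp add: qbounded_ops_qscale[OF qbounded] flip: TJ)
    then show ?thesis by (simp add: H_plus_def left_vec_def linear_scale[OF lin(1)] linear_scale[OF lin(2)])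
  qed
  then have x0: "x0 \<in> orthonormal_pairs J i"
    using e_H infsum_powr_attained(1,2) by (auto simp: x0_def orthonormal_pairs_def)
  have "M \<le> X x0" using infsum_powr_attained(3)[of p] by (simp add: M_def X_def x0_def)
  \<comment> \<open>\<open>M\<close> is thus the maximum of \<open>X\<close> over all pairs,
    attained at \<open>x0\<close>. Finiteness of every sum becomes finiteness of \<open>M\<close>,
    and the supremum of the roots becomes the root of \<open>M\<close> by monotonicity.\<close>
  with upper[OF x0] have M: "M = X x0" by (rule antisym[rotated])
  have "T \<in> schatten_class p J \<longleftrightarrow> summable (\<lambda>k. s k powr p)"
    using assms(6,7) by (simp add: schatten_class_def singular_values_eq)
  also have "\<dots> \<longleftrightarrow> M < \<infinity>"
    unfolding M_def infinity_ennreal_def less_top[symmetric]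
    by (rule iffI, rule ennreal_suminf_neq_top, assumption, rule powr_ge_zero,
        rule summable_suminf_not_top[OF powr_ge_zero])
  also have "\<dots> \<longleftrightarrow> (\<forall>x\<in>orthonormal_pairs J i. X x < \<infinity>)"
    using upper x0 M by (auto intro: le_less_trans)
  finally have first: "T \<in> schatten_class p J \<longleftrightarrow> (\<forall>x\<in>orthonormal_pairs J i. X x < \<infinity>)" .
  have "schatten_norm p T = ennreal_root p M"
    by (simp add: schatten_norm_def singular_values_eq M_def)
  also have "\<dots> = (SUP x\<in>orthonormal_pairs J i. ennreal_root p (X x))"
    using assms(8) x0 M upper
    by (intro antisym SUP_least ennreal_root_mono) (auto intro: SUP_upper)
  finally have second: "schatten_norm p T = (SUP x\<in>orthonormal_pairs J i. ennreal_root p (X x))" .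
  show ?thesis
    using first second by (simp add: X_def case_prod_unfold)
qed

end
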